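(* Let $\rho,\delta,\phi>0$, $\lambda_1\ge 0$, $\theta_1\in\mathbb{R}$, $\theta_2>-1$ with $\lambda_1\theta_1=0$, and let $\omega>\phi+1$. Set $$\kappa^*=\frac{\phi}{\phi+1}\left(\frac{\rho-\lambda_1\big((1+\theta_2)^{\omega-\phi}-1\big)}{\omega-\phi}+\delta\right),\qquad K^*=\left(\frac{\phi+1}{\phi\left(\frac{\rho-\lambda_1((1+\theta_2)^{\omega-\phi}-1)}{\omega-\phi}+\delta\right)}\right)^{1+\phi}.$$ For $a>0$ consider the problem of maximizing $$\mathbb{E}\left[\int_0^{+\infty}-A(t)^{\omega}\,c(t)^{-\phi}\,e^{-\rho t}\,dt\right]$$ over admissible controls $c(\cdot)$, where $A$ is the solution with $A(0)=a$ of $$dA(t)=[c(t)-\delta A(t)]\,dt+(\theta_1+\theta_2A(t^-))\,dN(t),$$ with $N$ a Poisson process of constant intensity $\lambda_1$. Then: 1. The optimal control is linear in the state: it is given in feedback form by $c^*(a)=\kappa^*a$. 2. The optimal value function is $$V^*(a)=-\frac{K^*\,\phi}{\omega-\phi}\,a^{\omega-\phi}.$$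
   Context: Admissible controls are the predictable processes $c$ with values in $(0,\infty)$ that are locally in time square integrable. The process $A$ (addiction capital) is a controlled piecewise deterministic Markov process: between jumps $\dot A=c-\delta A$, and at a jump time $\tau$ of $N$, $A(\tau)=A(\tau^-)+\theta_1+\theta_2A(\tau^-)$. The general model has jump intensity $\lambda(a)=\lambda_1+\lambda_2a$; here $\lambda_2=0$, so the intensity is the constant $\lambda_1$ (if $\lambda_1=0$ there are no jumps). The optimal value function at $a$ is the optimal value of the objective over admissible controls, for the starting point $A(0)=a$. A feedback $c^*(\cdot)$ means that the control applied at time $t$ is $c^*$ evaluated at the current state.
   Formalization: The formal theorem additionally assumes κ* > 0; without it (e.g. θ₂ > 0 and λ₁ large) the feedback c*(a) = κ*a is not positive, hence not admissible, and the claim fails. *)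

theory Defs
  imports "HOL-Probability.Probability"
begin

text \<open>
  Time is the half-line \<open>t \<ge> 0\<close> of type \<^typ>\<open>real\<close>; the values of processes and of the
  filtration at negative times play no role. No usual conditions (completeness,
  right-continuity) are imposed on the filtration. The increment law is written out, rather than
  taken from the Poisson pmf, so that it also covers intensity \<open>0\<close> (no jumps, almost surely).
\<close>

locale poisson_filtered_space = prob_space M + filtration "space M" F
  for M :: "'a measure" and F :: "real \<Rightarrow> 'a measure" +
  fixes N :: "real \<Rightarrow> 'a \<Rightarrow> nat" and lam :: real
  assumes intensity_nonneg: "0 \<le> lam"
    and sets_F_subset: "\<And>t. 0 \<le> t \<Longrightarrow> sets (F t) \<subseteq> sets M"
    and N_adapted: "\<And>t. 0 \<le> t \<Longrightarrow> N t \<in> measurable (F t) (count_space UNIV)"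
    and N_start: "\<And>x. x \<in> space M \<Longrightarrow> N 0 x = 0"
    and N_mono: "\<And>x s t. x \<in> space M \<Longrightarrow> 0 \<le> s \<Longrightarrow> s \<le> t \<Longrightarrow> N s x \<le> N t x"
    and N_right_cont: "\<And>x t. x \<in> space M \<Longrightarrow> 0 \<le> t \<Longrightarrow>
          ((\<lambda>s. N s x) \<longlongrightarrow> N t x) (at_right t)"
    and N_unit_jumps: "\<And>x t. x \<in> space M \<Longrightarrow> 0 < t \<Longrightarrow>
          eventually (\<lambda>s. N t x \<le> N s x + 1) (at_left t)"
    and N_increment_indep: "\<And>s t. 0 \<le> s \<Longrightarrow> s \<le> t \<Longrightarrow>
          indep_set (sets (F s)) {{x \<in> space M. N t x - N s x \<in> B} |B. B \<subseteq> UNIV}"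
    and N_increment_law: "\<And>s t k. 0 \<le> s \<Longrightarrow> s \<le> t \<Longrightarrow>
          prob {x \<in> space M. N t x - N s x = k}
            = (lam * (t - s)) ^ k / fact k * exp (- (lam * (t - s)))"

definition predictable_sigma :: "'a measure \<Rightarrow> (real \<Rightarrow> 'a measure) \<Rightarrow> (real \<times> 'a) measure" where
  "predictable_sigma M F = sigma ({0..} \<times> space M)
     ({{0} \<times> B |B. B \<in> sets (F 0)} \<union>
      {{s<..t} \<times> B |s t B. 0 \<le> s \<and> s \<le> t \<and> B \<in> sets (F s)})"

definition admissible :: "'a measure \<Rightarrow> (real \<Rightarrow> 'a measure) \<Rightarrow> (real \<Rightarrow> 'a \<Rightarrow> real) \<Rightarrow> bool" where
  "admissible M F c \<longleftrightarrow>
     (\<lambda>(t, x). c t x) \<in> borel_measurable (predictable_sigma M F) \<and>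
     (\<forall>t\<ge>0. \<forall>x\<in>space M. 0 < c t x) \<and>
     (\<forall>T\<ge>0. (\<integral>\<^sup>+ x. (\<integral>\<^sup>+ t\<in>{0..T}. ennreal ((c t x)\<^sup>2) \<partial>lborel) \<partial>M) < \<infinity>)"

text \<open>Left limits along a path, with the usual convention \<open>f(0-) = f(0)\<close> at the initial time.\<close>

definition left_lim :: "(real \<Rightarrow> real) \<Rightarrow> real \<Rightarrow> real" where
  "left_lim f t = (if t = 0 then f 0 else Lim (at_left t) f)"

definition jump_times :: "(real \<Rightarrow> nat) \<Rightarrow> real set" where
  "jump_times n = {t. 0 < t \<and> \<not> (n \<longlongrightarrow> n t) (at_left t)}"

text \<open>
  Adapted cadlag solutions of \<open>dA = (c - \<delta> A) dt + (\<theta>\<^sub>1 + \<theta>\<^sub>2 A(t-)) dN\<close>, \<open>A(0) = a\<close>, in integrated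
  form. The integral against \<open>N\<close> is the sum over the jump times up to \<open>t\<close>, which are finitely many
  and of unit height in a \<open>poisson_filtered_space\<close>.
\<close>

definition state_process ::
  "'a measure \<Rightarrow> (real \<Rightarrow> 'a measure) \<Rightarrow> (real \<Rightarrow> 'a \<Rightarrow> nat) \<Rightarrow> real \<Rightarrow> real \<Rightarrow> real \<Rightarrow>
   real \<Rightarrow> (real \<Rightarrow> 'a \<Rightarrow> real) \<Rightarrow> (real \<Rightarrow> 'a \<Rightarrow> real) \<Rightarrow> bool" where
  "state_process M F N \<delta> \<theta>\<^sub>1 \<theta>\<^sub>2 a c A \<longleftrightarrow>
     (\<forall>t\<ge>0. A t \<in> borel_measurable (F t)) \<and>
     (AE x in M.
        (\<forall>t\<ge>0. ((\<lambda>s. A s x) \<longlongrightarrow> A t x) (at_right t)) \<and>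
        (\<forall>t>0. \<exists>l. ((\<lambda>s. A s x) \<longlongrightarrow> l) (at_left t)) \<and>
        (\<forall>t\<ge>0. A t x = a + (LINT s:{0..t}|lborel. c s x - \<delta> * A s x)
             + (\<Sum>\<tau>\<in>jump_times (\<lambda>s. N s x) \<inter> {..t}. \<theta>\<^sub>1 + \<theta>\<^sub>2 * left_lim (\<lambda>s. A s x) \<tau>)))"

text \<open>
  The integrand of the objective is nonpositive, so its expected integral is a well-defined
  element of \<open>[-\<infinity>, 0]\<close>: minus the nonnegative integral of its negation.
\<close>

definition objective ::
  "'a measure \<Rightarrow> real \<Rightarrow> real \<Rightarrow> real \<Rightarrow> (real \<Rightarrow> 'a \<Rightarrow> real) \<Rightarrow> (real \<Rightarrow> 'a \<Rightarrow> real) \<Rightarrow> ereal" where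
  "objective M \<rho> \<phi> \<omega> c A =
     - enn2ereal (\<integral>\<^sup>+ x. (\<integral>\<^sup>+ t\<in>{0..}.
         ennreal (A t x powr \<omega> * c t x powr (- \<phi>) * exp (- \<rho> * t)) \<partial>lborel) \<partial>M)"

text \<open>Admissible controls are paired with a state process they generate from \<open>a\<close>.\<close>

definition controlled_pair ::
  "'a measure \<Rightarrow> (real \<Rightarrow> 'a measure) \<Rightarrow> (real \<Rightarrow> 'a \<Rightarrow> nat) \<Rightarrow> real \<Rightarrow> real \<Rightarrow> real \<Rightarrow>
   real \<Rightarrow> (real \<Rightarrow> 'a \<Rightarrow> real) \<Rightarrow> (real \<Rightarrow> 'a \<Rightarrow> real) \<Rightarrow> bool" where
  "controlled_pair M F N \<delta> \<theta>\<^sub>1 \<theta>\<^sub>2 a c A \<longleftrightarrow>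
     admissible M F c \<and> state_process M F N \<delta> \<theta>\<^sub>1 \<theta>\<^sub>2 a c A"

definition value_function ::
  "'a measure \<Rightarrow> (real \<Rightarrow> 'a measure) \<Rightarrow> (real \<Rightarrow> 'a \<Rightarrow> nat) \<Rightarrow> real \<Rightarrow> real \<Rightarrow> real \<Rightarrow>
   real \<Rightarrow> real \<Rightarrow> real \<Rightarrow> real \<Rightarrow> ereal" where
  "value_function M F N \<delta> \<theta>\<^sub>1 \<theta>\<^sub>2 \<rho> \<phi> \<omega> a =
     Sup {objective M \<rho> \<phi> \<omega> c A |c A. controlled_pair M F N \<delta> \<theta>\<^sub>1 \<theta>\<^sub>2 a c A}"

definition optimal_pair ::
  "'a measure \<Rightarrow> (real \<Rightarrow> 'a measure) \<Rightarrow> (real \<Rightarrow> 'a \<Rightarrow> nat) \<Rightarrow> real \<Rightarrow> real \<Rightarrow> real \<Rightarrow>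
   real \<Rightarrow> real \<Rightarrow> real \<Rightarrow> real \<Rightarrow> (real \<Rightarrow> 'a \<Rightarrow> real) \<Rightarrow> (real \<Rightarrow> 'a \<Rightarrow> real) \<Rightarrow> bool" where
  "optimal_pair M F N \<delta> \<theta>\<^sub>1 \<theta>\<^sub>2 \<rho> \<phi> \<omega> a c A \<longleftrightarrow>
     controlled_pair M F N \<delta> \<theta>\<^sub>1 \<theta>\<^sub>2 a c A \<and>
     (\<forall>c' A'. controlled_pair M F N \<delta> \<theta>\<^sub>1 \<theta>\<^sub>2 a c' A' \<longrightarrow>
        objective M \<rho> \<phi> \<omega> c' A' \<le> objective M \<rho> \<phi> \<omega> c A)"

text \<open>
  A predictable control in feedback form reacts to the state just before a possible jump, \<open>A(t-)\<close>;
  this differs from \<open>A(t)\<close> only at jump times, a Lebesgue-null set of times.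
\<close>

definition feedback_control ::
  "'a measure \<Rightarrow> (real \<Rightarrow> real) \<Rightarrow> (real \<Rightarrow> 'a \<Rightarrow> real) \<Rightarrow> (real \<Rightarrow> 'a \<Rightarrow> real) \<Rightarrow> bool" where
  "feedback_control M g c A \<longleftrightarrow>
     (AE x in M. \<forall>t\<ge>0. c t x = g (left_lim (\<lambda>s. A s x) t))"

definition kappa_star :: "real \<Rightarrow> real \<Rightarrow> real \<Rightarrow> real \<Rightarrow> real \<Rightarrow> real \<Rightarrow> real" where
  "kappa_star \<rho> \<delta> \<phi> lam\<^sub>1 \<theta>\<^sub>2 \<omega> =
     \<phi> / (\<phi> + 1) * ((\<rho> - lam\<^sub>1 * ((1 + \<theta>\<^sub>2) powr (\<omega> - \<phi>) - 1)) / (\<omega> - \<phi>) + \<delta>)"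

definition K_star :: "real \<Rightarrow> real \<Rightarrow> real \<Rightarrow> real \<Rightarrow> real \<Rightarrow> real \<Rightarrow> real" where
  "K_star \<rho> \<delta> \<phi> lam\<^sub>1 \<theta>\<^sub>2 \<omega> =
     ((\<phi> + 1) / (\<phi> * ((\<rho> - lam\<^sub>1 * ((1 + \<theta>\<^sub>2) powr (\<omega> - \<phi>) - 1)) / (\<omega> - \<phi>) + \<delta>))) powr (1 + \<phi>)"

end

theory Submission
  imports Defs
begin

text \<open>
  Divide out the uncontrolled dynamics: \<open>A = D B\<close> with \<open>D(t) = exp(-\<delta> t) (1 + \<theta>\<^sub>2)^N(t)\<close> and
  \<open>B' = c / D\<close>. Put \<open>q = (\<omega> - \<phi>) / \<phi>\<close> and \<open>H = B' B^(-q-1) = -(B^(-q) / q)'\<close>. Then every path satisfies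
  the linear constraint \<open>\<integral> H \<le> a^(-q) / q\<close>, and the running cost is \<open>D^(\<omega>-\<phi>) exp(-\<rho> t) H^(-\<phi>)\<close>,
  which is convex in \<open>H\<close>. The weight \<open>D^(\<omega>-\<phi>) exp(-\<rho> t)\<close> is a deterministic exponential times the
  martingale \<open>Z\<close> (\<open>power_martingale\<close>) built from \<open>(1 + \<theta>\<^sub>2)^((\<omega>-\<phi>) N(t))\<close>, and the tangent to \<open>H^(-\<phi>)\<close> at
  \<open>H\<^sup>*(t) = \<kappa>\<^sup>* a^(-q) exp(-\<kappa>\<^sup>* q t)\<close> has slope proportional to \<open>Z\<close> after weighting. Since
  \<open>E \<integral> Z H \<le> a^(-q) / q\<close>, with equality for \<open>H\<^sup>*\<close>, Young's inequality makes \<open>H\<^sup>*\<close> the unique minimiser,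
  and \<open>H = H\<^sup>*\<close> is the feedback \<open>c = \<kappa>\<^sup>* A\<close>. No transversality condition or HJB equation is needed.
\<close>

section \<open>Increments and primitives\<close>

text \<open>The exponent \<open>q\<close> solves \<open>(q + 1) * \<phi> = \<omega>\<close>: with
  \<open>c = H D B^(q+1)\<close> all powers of \<open>B\<close> cancel from
  \<open>A^\<omega> c^(-\<phi>)\<close>, and \<open>H\<close> is the only trace of the control left
  in the cost. The hypothesis \<open>lam\<^sub>1 * \<theta>\<^sub>1 = 0\<close> makes the jump
  equation homogeneous on almost every path, which is what permits the common factor
  \<open>D\<close>. Three obstacles shape the rest. Controls are only locally integrable along a
  path, so identities between primitives are obtained by comparing right-hand increments instead of
  differentiating. The weight \<open>Z\<close> is random, so a pathwise bound on \<integral> H says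
  nothing by itself about \<integral> Z H; it is the adaptedness of \<open>H\<close> that transfers
  the bound. Finally the cost may be infinite, so Young's inequality is integrated as an identity
  between nonnegative terms, from which only finite ones are cancelled. Positivity of
  \<open>kappa_star\<close> enters because \<open>H_opt\<close>, which decays at rate
  \<open>\<kappa> * q\<close>, must use up the whole constraint on the infinite horizon.\<close>

lemma real_induction:
  fixes P :: "real \<Rightarrow> bool"
  assumes zero: "P 0"
    and left: "\<And>t. 0 < t \<Longrightarrow> (\<And>s. 0 \<le> s \<Longrightarrow> s < t \<Longrightarrow> P s) \<Longrightarrow> P t"
    and right: "\<And>t. 0 \<le> t \<Longrightarrow> P t \<Longrightarrow> eventually P (at_right t)"
    and t: "0 \<le> t"
  shows "P t"
proof (rule ccontr)
  assume "\<not> P t"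
  define S where "S = {s. 0 \<le> s \<and> \<not> P s}"
  have ne: "S \<noteq> {}" and bdd: "bdd_below S"
    using t \<open>\<not> P t\<close> by (auto simp: S_def intro: bdd_belowI[of _ 0])
  \<comment> \<open>The first point of failure: \<open>left\<close> makes \<open>P m\<close> true,
    and \<open>right\<close> then keeps all failures at a positive distance above
    \<open>m\<close>.\<close>
  define m where "m = Inf S"
  have m0: "0 \<le> m" unfolding m_def by (rule cInf_greatest[OF ne]) (auto simp: S_def)
  have below: "P s" if "0 \<le> s" "s < m" for s
    using cInf_lower[OF _ bdd, of s] that by (force simp: m_def S_def)
  have Pm: "P m"
    using zero left[of m] below m0 by (cases "m = 0") auto
  from right[OF m0 Pm] obtain u where u: "m < u" "\<And>y. m < y \<Longrightarrow> y < u \<Longrightarrow> P y"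
    unfolding eventually_at_right_field by blast
  have "u \<le> s" if "s \<in> S" for s
    using that u(2)[of s] cInf_lower[OF that bdd] Pm by (force simp: m_def S_def)
  then have "u \<le> m" unfolding m_def by (rule cInf_greatest[OF ne])
  with u show False by simp
qed

text \<open>For each \<open>e\<close> the bound \<open>\<bar>f t\<bar> \<le> e * (w t - w 0)\<close>
  propagates by real induction, through left limits by continuity and to the right by
  \<open>inc\<close>; then \<open>e\<close> tends to 0. Taking for \<open>w\<close> a primitive of
  an integrable function covers functions that are merely absolutely continuous.\<close>

lemma vanishing_increments:
  fixes f w :: "real \<Rightarrow> real"
  assumes zero: "f 0 = 0"
    and fleft: "\<And>t. 0 < t \<Longrightarrow> (f \<longlongrightarrow> f t) (at_left t)"
    and wleft: "\<And>t. 0 < t \<Longrightarrow> (w \<longlongrightarrow> w t) (at_left t)"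
    and inc: "\<And>t e. 0 \<le> t \<Longrightarrow> 0 < e \<Longrightarrow>
           eventually (\<lambda>u. \<bar>f u - f t\<bar> \<le> e * (w u - w t)) (at_right t)"
    and t: "0 \<le> t"
  shows "f t = 0"
proof -
  have bound: "\<bar>f t\<bar> \<le> e * (w t - w 0)" if e: "0 < e" for e
  proof (rule real_induction[where P = "\<lambda>t. \<bar>f t\<bar> \<le> e * (w t - w 0)", OF _ _ _ t])
    show "\<bar>f 0\<bar> \<le> e * (w 0 - w 0)" using zero by simp
  next
    fix t :: real assume t: "0 < t" and IH: "\<And>s. 0 \<le> s \<Longrightarrow> s < t \<Longrightarrow> \<bar>f s\<bar> \<le> e * (w s - w 0)"
    have ev: "eventually (\<lambda>s. \<bar>f s\<bar> \<le> e * (w s - w 0)) (at_left t)"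
      using eventually_at_left_real[OF t] by eventually_elim (auto intro: IH)
    show "\<bar>f t\<bar> \<le> e * (w t - w 0)"
      by (rule tendsto_le[OF _ _ _ ev]) (auto intro!: tendsto_intros fleft wleft t)
  next
    fix t :: real assume t: "0 \<le> t" and IH: "\<bar>f t\<bar> \<le> e * (w t - w 0)"
    show "eventually (\<lambda>s. \<bar>f s\<bar> \<le> e * (w s - w 0)) (at_right t)"
      using inc[OF t e]
    proof eventually_elim
      case (elim u)
      have "\<bar>f u\<bar> \<le> \<bar>f u - f t\<bar> + \<bar>f t\<bar>" by linarith
      also have "\<dots> \<le> e * (w u - w t) + e * (w t - w 0)" using elim IH by linarith
      finally show ?case by (simp add: algebra_simps)
    qed
  qed
  have "\<bar>f t\<bar> \<le> d" if "0 < d" for d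
  proof -
    define e where "e = d / (\<bar>w t - w 0\<bar> + 1)"
    have e: "0 < e" unfolding e_def using that by (intro divide_pos_pos) auto
    have "\<bar>f t\<bar> \<le> e * (w t - w 0)" by (rule bound[OF e])
    also have "\<dots> \<le> e * (\<bar>w t - w 0\<bar> + 1)" using e by (intro mult_left_mono) auto
    also have "\<dots> = d" unfolding e_def by (simp add: add_nonneg_eq_0_iff)
    finally show ?thesis .
  qed
  then show ?thesis using field_le_epsilon[of "\<bar>f t\<bar>" 0] by simp
qed

section \<open>Set integrals over intervals and their primitives\<close>

lemma set_integrable_mult_bounded:
  fixes f g :: "real \<Rightarrow> real"
  assumes f: "set_integrable lborel {s..t} f"
    and m: "(\<lambda>x. indicator {s..t} x *\<^sub>R g x) \<in> borel_measurable borel"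
    and K: "\<And>x. x \<in> {s..t} \<Longrightarrow> \<bar>g x\<bar> \<le> K"
  shows "set_integrable lborel {s..t} (\<lambda>x. f x * g x)"
proof -
  have fi: "integrable lborel (\<lambda>x. indicator {s..t} x *\<^sub>R f x)"
    using f by (simp add: set_integrable_def)
  have eq: "indicator {s..t} x *\<^sub>R (f x * g x) = (indicator {s..t} x *\<^sub>R f x) * (indicator {s..t} x *\<^sub>R g x)" for x
    by (simp split: split_indicator)
  have "integrable lborel (\<lambda>x. indicator {s..t} x *\<^sub>R (f x * g x))"
  proof (rule Bochner_Integration.integrable_bound[OF integrable_mult_right[OF integrable_abs[OF fi], of "\<bar>K\<bar>"]])
    show "(\<lambda>x. indicator {s..t} x *\<^sub>R (f x * g x)) \<in> borel_measurable lborel"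
      unfolding eq using fi m by (intro borel_measurable_times) auto
    have "\<bar>f x\<bar> * \<bar>g x\<bar> \<le> \<bar>K\<bar> * \<bar>f x\<bar>" if "x \<in> {s..t}" for x
      using mult_right_mono[OF order_trans[OF K[OF that] abs_ge_self], of "\<bar>f x\<bar>"]
      by (simp add: mult.commute)
    then show "AE x in lborel. norm (indicator {s..t} x *\<^sub>R (f x * g x))
        \<le> norm (\<bar>K\<bar> * \<bar>indicator {s..t} x *\<^sub>R f x\<bar>)"
      by (intro AE_I2) (auto simp: abs_mult split: split_indicator)
  qed
  then show ?thesis by (simp add: set_integrable_def)
qed

lemma set_integrable_mult_continuous:
  fixes f g :: "real \<Rightarrow> real"
  assumes f: "set_integrable lborel {s..t} f" and g: "continuous_on {s..t} g"
  shows "set_integrable lborel {s..t} (\<lambda>x. f x * g x)"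
proof -
  have "compact (g ` {s..t})" by (rule compact_continuous_image[OF g]) simp
  then obtain K where "\<And>x. x \<in> {s..t} \<Longrightarrow> \<bar>g x\<bar> \<le> K"
    using compact_imp_bounded[of "g ` {s..t}"] unfolding bounded_iff by fastforce
  with f borel_measurable_continuous_on_indicator[OF _ g] show ?thesis
    by (intro set_integrable_mult_bounded) auto
qed

lemma set_integral_singleton_lborel:
  fixes f :: "real \<Rightarrow> real"
  shows "(LINT v:{t..t}|lborel. f v) = 0"
proof -
  have "AE v in lborel. v \<noteq> t" using AE_lborel_singleton[of t] by simp
  then have "AE v in lborel. indicator {t..t} v *\<^sub>R f v = 0"
    by eventually_elim auto
  then show ?thesis
    unfolding set_lebesgue_integral_def by (rule integral_eq_zero_AE)
qed

lemma set_integral_split: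
  fixes f :: "real \<Rightarrow> real"
  assumes f: "set_integrable lborel {0..t} f" and "0 \<le> s" "s \<le> t"
  shows "(LINT v:{0..t}|lborel. f v) = (LINT v:{0..s}|lborel. f v) + (LINT v:{s..t}|lborel. f v)"
proof -
  have U: "{0..t} = {0..s} \<union> {s..t}" using assms by auto
  show ?thesis unfolding U
  proof (rule set_integral_Un_AE)
    show "AE x in lborel. \<not> (x \<in> {0..s} \<and> x \<in> {s..t})"
      by (rule AE_I'[of "{s}"]) (auto simp: null_sets_def)
  qed (use assms in \<open>auto intro!: set_integrable_subset[OF f]\<close>)
qed

lemma set_integral_continuous:
  fixes f :: "real \<Rightarrow> real"
  assumes f: "\<And>T. set_integrable lborel {0..T} f"
  shows "continuous_on {0..} (\<lambda>t. LINT v:{0..t}|lborel. f v)"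
proof -
  have "continuous_on {0..T} (\<lambda>t. LINT v:{0..t}|lborel. f v)" for T
  proof (rule continuous_on_eq)
    show "continuous_on {0..T} (\<lambda>t. integral {0..t} f)"
      by (intro indefinite_integral_continuous_1 set_borel_integral_eq_integral f)
  qed (simp add: set_borel_integral_eq_integral(2)[OF f])
  then have cont: "continuous (at t within {0..t+1}) (\<lambda>t. LINT v:{0..t}|lborel. f v)" if "0 \<le> t" for t
    using that unfolding continuous_on_eq_continuous_within by auto
  have "at t within {0..t+1} = at t within {0..}" for t :: real
    by (rule at_within_nhd[of t "{..<t+1}"]) auto
  with cont show ?thesis unfolding continuous_on_eq_continuous_within by auto
qed

lemma continuous_on_atLeast_at_left:
  fixes f :: "real \<Rightarrow> real"
  assumes "continuous_on {0..} f" "0 < t"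
  shows "(f \<longlongrightarrow> f t) (at_left t)"
proof -
  have "isCont f t"
    using continuous_on_interior[OF assms(1), of t] assms(2) by (simp add: interior_real_atLeast)
  then show ?thesis
    by (simp add: isCont_def filterlim_at_split)
qed

lemma continuous_on_atLeast_at_right:
  fixes f :: "real \<Rightarrow> real"
  assumes "continuous_on {0..} f" "0 \<le> t"
  shows "(f \<longlongrightarrow> f t) (at_right t)"
proof -
  have "(f \<longlongrightarrow> f t) (at t within {0..})"
    using assms by (auto simp: continuous_on_def)
  then show ?thesis
    by (rule tendsto_within_subset) (use assms in auto)
qed

text \<open>The left endpoint is exempt because right-hand limits at \<open>s\<close> control the
  integrand only beyond \<open>s\<close>; a single point is null.\<close>

lemma abs_set_integral_le:
  fixes f g h :: "real \<Rightarrow> real"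
  assumes f: "set_integrable lborel {s..u} f" and g: "set_integrable lborel {s..u} g"
    and le: "\<And>v. s < v \<Longrightarrow> v \<le> u \<Longrightarrow> \<bar>f v\<bar> \<le> g v"
  shows "\<bar>LINT v:{s..u}|lborel. f v\<bar> \<le> (LINT v:{s..u}|lborel. g v)"
proof -
  have "\<bar>LINT v:{s..u}|lborel. f v\<bar> \<le> (LINT v:{s..u}|lborel. \<bar>f v\<bar>)"
    using integral_norm_bound[of lborel "\<lambda>v. indicator {s..u} v *\<^sub>R f v"]
    by (simp add: set_lebesgue_integral_def abs_mult)
  also have "\<dots> \<le> (LINT v:{s..u}|lborel. g v)"
  proof (rule set_integral_mono_AE[OF set_integrable_abs[OF f] g])
    have "AE v in lborel. v \<noteq> s" using AE_lborel_singleton[of s] by simp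
    then show "AE v\<in>{s..u} in lborel. \<bar>f v\<bar> \<le> g v"
      by eventually_elim (auto intro: le)
  qed
  finally show ?thesis .
qed

text \<open>The primitive of \<open>b\<close> need not be differentiable anywhere prescribed, so the chain rule is
  obtained from \<open>vanishing_increments\<close> with the primitive itself as the control function.\<close>

lemma chain_rule_primitive:
  fixes b G g :: "real \<Rightarrow> real" and a :: real
  defines "B \<equiv> \<lambda>t. a + (LINT v:{0..t}|lborel. b v)"
  assumes b: "\<And>T. set_integrable lborel {0..T} b" and nonneg: "\<And>v. 0 \<le> v \<Longrightarrow> 0 \<le> b v"
    and G: "\<And>y. a \<le> y \<Longrightarrow> (G has_real_derivative g y) (at y)"
    and g: "continuous_on {a..} g"
    and t: "0 \<le> t"
  shows "set_integrable lborel {0..t} (\<lambda>v. b v * g (B v))"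
    and "(LINT v:{0..t}|lborel. b v * g (B v)) = G (B t) - G a"
proof -
  have contB: "continuous_on {0..} B"
    unfolding B_def by (intro continuous_intros set_integral_continuous b)
  have incB: "B u - B s = (LINT v:{s..u}|lborel. b v)" if "0 \<le> s" "s \<le> u" for s u
    using set_integral_split[OF b that] by (simp add: B_def)
  have B0: "B 0 = a"
    by (simp add: B_def set_integral_singleton_lborel del: atLeastAtMost_singleton)
  have monoB: "B s \<le> B u" if "0 \<le> s" "s \<le> u" for s u
  proof -
    have "0 \<le> (LINT v:{s..u}|lborel. b v)"
      unfolding set_lebesgue_integral_def using that
      by (intro integral_nonneg_AE AE_I2) (auto intro!: nonneg split: split_indicator)
    with incB[OF that] show ?thesis by simp
  qed
  have geB: "a \<le> B u" if "0 \<le> u" for u using monoB[OF order_refl that] B0 by simp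
  have gB: "continuous_on {0..} (\<lambda>v. g (B v))"
    by (rule continuous_on_compose2[OF g contB]) (auto intro: geB)
  have int: "set_integrable lborel {0..T} (\<lambda>v. b v * g (B v))" for T
    by (rule set_integrable_mult_continuous[OF b continuous_on_subset[OF gB]]) auto
  then show "set_integrable lborel {0..t} (\<lambda>v. b v * g (B v))" .
  define E where "E = (\<lambda>t. (LINT v:{0..t}|lborel. b v * g (B v)) - (G (B t) - G a))"
  have contG: "continuous_on {a..} G"
    by (rule DERIV_continuous_on[where D = g]) (simp add: G has_field_derivative_at_within)
  have contE: "continuous_on {0..} E"
    unfolding E_def
    by (intro continuous_intros set_integral_continuous int continuous_on_compose2[OF contG contB])
      (auto intro: geB)
  have "E t = 0"
  proof (rule vanishing_increments[where w = B, OF _ _ _ _ t])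
    show "E 0 = 0"
      by (simp add: E_def B0 set_integral_singleton_lborel del: atLeastAtMost_singleton)
  next
    fix t e :: real assume t: "0 \<le> t" and e: "0 < e"
    have "((\<lambda>v. g (B v)) \<longlongrightarrow> g (B t)) (at_right t)"
      by (rule continuous_on_atLeast_at_right[OF gB t])
    then have "eventually (\<lambda>v. dist (g (B v)) (g (B t)) < e/2) (at_right t)"
      using e by (intro tendstoD) auto
    then obtain r where r: "t < r" and close: "\<And>v. t < v \<Longrightarrow> v < r \<Longrightarrow> \<bar>g (B v) - g (B t)\<bar> < e/2"
      unfolding eventually_at_right_field by (auto simp: dist_real_def)
    show "eventually (\<lambda>u. \<bar>E u - E t\<bar> \<le> e * (B u - B t)) (at_right t)"
      using eventually_at_right_real[OF r]
    proof eventually_elim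
      case (elim u)
      then have u: "t < u" "u < r" by auto
      have "continuous_on {t..u} B" by (rule continuous_on_subset[OF contB]) (use t in auto)
      \<comment> \<open>The mean value theorem for \<open>G\<close> gives an intermediate value of
        \<open>B\<close>, and the intermediate value theorem pulls it back to a time
        \<open>x\<close>. If \<open>B\<close> does not move, any time serves.\<close>
      obtain x where x: "t \<le> x" "x \<le> u" and Gx: "G (B u) - G (B t) = g (B x) * (B u - B t)"
      proof (cases "B t = B u")
        case True then show ?thesis using that[of t] u by simp
      next
        case False
        then have lt: "B t < B u" using monoB[of t u] t u by simp
        obtain z where z: "B t < z" "z < B u" "G (B u) - G (B t) = (B u - B t) * g z"
          using MVT2[OF lt, of G g] G geB[OF t] by (meson order_trans)
        obtain x where "t \<le> x" "x \<le> u" "B x = z"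
          using IVT'[of B t z u] z u \<open>continuous_on {t..u} B\<close> by auto
        then show ?thesis using that[of x] z by (simp add: mult.commute)
      qed
      have gx: "\<bar>g (B x) - g (B t)\<bar> \<le> e/2" using close[of x] x u e by (cases "x = t") auto
      have bi: "set_integrable lborel {t..u} b"
        by (rule set_integrable_subset[OF b[of u]]) (use t in auto)
      have bgi: "set_integrable lborel {t..u} (\<lambda>v. b v * g (B v))"
        by (rule set_integrable_subset[OF int[of u]]) (use t in auto)
      have "E u - E t = (LINT v:{t..u}|lborel. b v * g (B v)) - (G (B u) - G (B t))"
        unfolding E_def using set_integral_split[OF int t less_imp_le[OF u(1)]] by simp
      \<comment> \<open>Since \<open>B u - B t\<close> is itself the integral of \<open>b\<close>,
        both terms merge into one integral with the small factor
        \<open>g (B v) - g (B x)\<close>.\<close>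
      also have "\<dots> = (LINT v:{t..u}|lborel. b v * g (B v) - b v * g (B x))"
        using bi bgi incB[OF t less_imp_le[OF u(1)]] by (simp add: Gx mult.commute)
      finally have "\<bar>E u - E t\<bar> \<le> (LINT v:{t..u}|lborel. e * b v)"
      proof (simp only:, intro abs_set_integral_le)
        show "set_integrable lborel {t..u} (\<lambda>v. b v * g (B v) - b v * g (B x))"
          using bi bgi by (intro set_integral_diff) auto
        show "set_integrable lborel {t..u} (\<lambda>v. e * b v)" using bi by auto
        fix v assume v: "t < v" "v \<le> u"
        have "\<bar>g (B v) - g (B x)\<bar> \<le> e" using close[of v] gx v u by linarith
        then have "b v * \<bar>g (B v) - g (B x)\<bar> \<le> b v * e"
          using nonneg[of v] t v by (intro mult_left_mono) auto
        moreover have "\<bar>b v * g (B v) - b v * g (B x)\<bar> = b v * \<bar>g (B v) - g (B x)\<bar>"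
          using nonneg[of v] t v by (simp add: abs_mult flip: right_diff_distrib)
        ultimately show "\<bar>b v * g (B v) - b v * g (B x)\<bar> \<le> e * b v"
          by (simp add: mult.commute)
      qed
      then show ?case using incB[OF t less_imp_le[OF u(1)]] by simp
    qed
  qed (use contE contB in \<open>auto intro: continuous_on_atLeast_at_left\<close>)
  then show "(LINT v:{0..t}|lborel. b v * g (B v)) = G (B t) - G a" by (simp add: E_def)
qed

section \<open>Counting paths and linear equations with jumps\<close>

definition cadlag :: "(real \<Rightarrow> real) \<Rightarrow> bool" where
  "cadlag f \<longleftrightarrow> (\<forall>t\<ge>0. (f \<longlongrightarrow> f t) (at_right t)) \<and> (\<forall>t>0. \<exists>l. (f \<longlongrightarrow> l) (at_left t))"

text \<open>Sampling at grid times to the right of \<open>t\<close> involves only countably many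
  sections, hence is jointly measurable; right-continuity gives the limit as the grid is
  refined.\<close>

lemma measurable_right_continuous_pair:
  fixes f :: "real \<Rightarrow> 'a \<Rightarrow> real"
  assumes meas: "\<And>t. 0 \<le> t \<Longrightarrow> f t \<in> borel_measurable M"
    and rc: "\<And>t x. 0 \<le> t \<Longrightarrow> x \<in> space M \<Longrightarrow> ((\<lambda>s. f s x) \<longlongrightarrow> f t x) (at_right t)"
  shows "(\<lambda>(t, x). indicator {0..} t * f t x) \<in> borel_measurable (borel \<Otimes>\<^sub>M M)"
proof (rule borel_measurable_LIMSEQ_real)
  \<comment> \<open>The added 1 puts the grid point strictly after \<open>t\<close> even when
    \<open>t\<close> lies on the grid, as a limit along \<open>at_right t\<close> requires.\<close>
  define r where "r = (\<lambda>(k::nat) (t::real). (real (nat \<lfloor>real (Suc k) * t\<rfloor>) + 1) / real (Suc k))"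
  have gt: "t < r k t" and le: "r k t \<le> t + 1 / real (Suc k)" if "0 \<le> t" for k t
  proof -
    have "0 \<le> \<lfloor>real (Suc k) * t\<rfloor>" using that by simp
    then have eq: "real (nat \<lfloor>real (Suc k) * t\<rfloor>) = real_of_int \<lfloor>real (Suc k) * t\<rfloor>" by simp
    have "real (Suc k) * t < real_of_int \<lfloor>real (Suc k) * t\<rfloor> + 1" by linarith
    then show "t < r k t" unfolding r_def eq by (simp add: pos_less_divide_eq mult.commute)
    have "real_of_int \<lfloor>real (Suc k) * t\<rfloor> \<le> real (Suc k) * t" by linarith
    then have "(real_of_int \<lfloor>real (Suc k) * t\<rfloor> + 1) / real (Suc k) \<le> (real (Suc k) * t + 1) / real (Suc k)"
      by (intro divide_right_mono) auto
    also have "\<dots> = t + 1 / real (Suc k)" by (simp add: add_divide_distrib)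
    finally show "r k t \<le> t + 1 / real (Suc k)" unfolding r_def eq .
  qed
  show "(\<lambda>(t, x). indicator {0..} t * f (r k t) x) \<in> borel_measurable (borel \<Otimes>\<^sub>M M)" for k
  proof -
    have "(\<lambda>p. f ((real (nat \<lfloor>real (Suc k) * fst p\<rfloor>) + 1) / real (Suc k)) (snd p))
        \<in> borel_measurable (borel \<Otimes>\<^sub>M M)"
    proof (rule measurable_compose_countable'[where I = UNIV and f = "\<lambda>i p. f ((real i + 1) / real (Suc k)) (snd p)"])
      show "(\<lambda>p. f ((real i + 1) / real (Suc k)) (snd p)) \<in> borel_measurable (borel \<Otimes>\<^sub>M M)" for i
        by (rule measurable_compose[OF measurable_snd meas]) simp
      show "(\<lambda>p. nat \<lfloor>real (Suc k) * fst p\<rfloor>) \<in> borel \<Otimes>\<^sub>M M \<rightarrow>\<^sub>M count_space UNIV"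
        by measurable
    qed simp
    then show ?thesis unfolding r_def case_prod_beta by measurable
  qed
  fix p :: "real \<times> 'a" assume "p \<in> space (borel \<Otimes>\<^sub>M M)"
  then obtain t x where p: "p = (t, x)" and x: "x \<in> space M" by (auto simp: space_pair_measure)
  show "(\<lambda>k. (case p of (t, x) \<Rightarrow> indicator {0..} t * f (r k t) x))
      \<longlonglongrightarrow> (case p of (t, x) \<Rightarrow> indicator {0..} t * f t x)"
  proof (cases "0 \<le> t")
    case True
    have "(\<lambda>k. r k t) \<longlonglongrightarrow> t"
    proof (rule tendsto_sandwich[OF _ _ tendsto_const])
      show "(\<lambda>k. t + 1 / real (Suc k)) \<longlonglongrightarrow> t"
        using tendsto_add[OF tendsto_const[of t] LIMSEQ_inverse_real_of_nat]
        by (simp add: inverse_eq_divide)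
    qed (use gt[OF True] le[OF True] in \<open>auto intro!: always_eventually less_imp_le\<close>)
    then have "filterlim (\<lambda>k. r k t) (at_right t) sequentially"
      using gt[OF True] by (intro tendsto_imp_filterlim_at_right) auto
    from filterlim_compose[OF rc[OF True x] this] True show ?thesis by (simp add: p)
  qed (simp add: p)
qed

lemma cadlag_measurable:
  assumes "cadlag f" and "0 \<le> s"
  shows "(\<lambda>x. indicator {s..t} x *\<^sub>R f x) \<in> borel_measurable borel"
proof -
  \<comment> \<open>A deterministic path is a process on a one-point space.\<close>
  have "(\<lambda>(t, x::unit). indicator {0..} t * f t) \<in> borel_measurable (borel \<Otimes>\<^sub>M count_space UNIV)"
    using assms by (intro measurable_right_continuous_pair) (auto simp: cadlag_def)
  then have "(\<lambda>t. (\<lambda>(t, x::unit). indicator {0..} t * f t) (t, ())) \<in> borel_measurable borel"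
    by (rule measurable_compose[rotated]) simp
  then have "(\<lambda>t. indicator {0..} t * f t) \<in> borel_measurable borel" by simp
  then have "(\<lambda>x. indicator {s..t} x * (indicator {0..} x * f x)) \<in> borel_measurable borel"
    by measurable
  also have "(\<lambda>x. indicator {s..t} x * (indicator {0..} x * f x)) = (\<lambda>x. indicator {s..t} x *\<^sub>R f x)"
    using assms(2) by (auto split: split_indicator)
  finally show ?thesis .
qed

text \<open>Real induction: near \<open>t\<close> the function stays within 1 of its one-sided
  limit, and the induction hypothesis bounds the rest.\<close>

lemma cadlag_bounded:
  assumes f: "cadlag f"
  shows "\<exists>K. \<forall>s\<in>{0..t}. \<bar>f s\<bar> \<le> K"
proof (cases "0 \<le> t")
  case True
  then show ?thesis
  proof (rule real_induction[rotated 3])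
    fix t :: real assume t: "0 < t" and IH: "\<And>s. 0 \<le> s \<Longrightarrow> s < t \<Longrightarrow> \<exists>K. \<forall>v\<in>{0..s}. \<bar>f v\<bar> \<le> K"
    from f t obtain l where "(f \<longlongrightarrow> l) (at_left t)" by (auto simp: cadlag_def)
    then have "eventually (\<lambda>v. dist (f v) l < 1) (at_left t)" by (rule tendstoD) simp
    then obtain s where s: "s < t" "\<And>v. s < v \<Longrightarrow> v < t \<Longrightarrow> \<bar>f v - l\<bar> < 1"
      unfolding eventually_at_left_field by (auto simp: dist_real_def)
    from IH[of "max 0 s"] s t obtain K where K: "\<forall>v\<in>{0..max 0 s}. \<bar>f v\<bar> \<le> K" by auto
    have "\<bar>f v\<bar> \<le> max K (max (\<bar>l\<bar> + 1) \<bar>f t\<bar>)" if v: "v \<in> {0..t}" for v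
    proof -
      consider "v \<le> max 0 s" | "s < v" "v < t" | "v = t" using v by atomize_elim auto
      then show ?thesis
      proof cases
        case 2 then show ?thesis using s(2)[of v] by linarith
      qed (use K v in \<open>auto simp: le_max_iff_disj\<close>)
    qed
    then show "\<exists>K. \<forall>v\<in>{0..t}. \<bar>f v\<bar> \<le> K" by blast
  next
    fix t :: real assume t: "0 \<le> t" and IH: "\<exists>K. \<forall>v\<in>{0..t}. \<bar>f v\<bar> \<le> K"
    then obtain K where K: "\<forall>v\<in>{0..t}. \<bar>f v\<bar> \<le> K" by blast
    from f t have "(f \<longlongrightarrow> f t) (at_right t)" by (auto simp: cadlag_def)
    then have "eventually (\<lambda>v. dist (f v) (f t) < 1) (at_right t)" by (rule tendstoD) simp
    then obtain r where r: "t < r" "\<And>v. t < v \<Longrightarrow> v < r \<Longrightarrow> \<bar>f v - f t\<bar> < 1"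
      unfolding eventually_at_right_field by (auto simp: dist_real_def)
    have "\<bar>f v\<bar> \<le> max K (\<bar>f t\<bar> + 1)" if "v \<in> {0..u}" "u < r" for u v
    proof (cases "v \<le> t")
      case True
      with K that show ?thesis by (simp add: le_max_iff_disj)
    next
      case False
      with r(2)[of v] that have "\<bar>f v - f t\<bar> < 1" by simp
      then show ?thesis by linarith
    qed
    then have "\<exists>K. \<forall>v\<in>{0..u}. \<bar>f v\<bar> \<le> K" if "u < r" for u using that by blast
    then show "eventually (\<lambda>u. \<exists>K. \<forall>v\<in>{0..u}. \<bar>f v\<bar> \<le> K) (at_right t)"
      using r(1) unfolding eventually_at_right_field by blast
  qed auto
qed auto

lemma set_integrable_mult_cadlag:
  assumes f: "set_integrable lborel {0..t} f" and g: "cadlag g"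
  shows "set_integrable lborel {0..t} (\<lambda>x. f x * g x)"
proof -
  obtain K where "\<forall>s\<in>{0..t}. \<bar>g s\<bar> \<le> K" using cadlag_bounded[OF g] by blast
  with f cadlag_measurable[OF g] show ?thesis by (intro set_integrable_mult_bounded) auto
qed

lemma set_integrable_const: "set_integrable lborel {s..t::real} (\<lambda>_. k::real)"
proof -
  have "integrable lborel (indicator {s..t} :: real \<Rightarrow> real)"
    by (rule integrable_real_indicator) (auto simp: emeasure_lborel_Icc_eq)
  then show ?thesis by (simp add: set_integrable_def)
qed

lemma set_integrable_cadlag:
  "cadlag g \<Longrightarrow> set_integrable lborel {0..t} g"
  using set_integrable_mult_cadlag[OF set_integrable_const[of 0 t 1]] by simp

section \<open>Simple counting paths, isolated from probability so that the jump equation can be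
  solved path by path\<close>

locale counting_path =
  fixes n :: "real \<Rightarrow> nat"
  assumes mono: "\<And>s t. 0 \<le> s \<Longrightarrow> s \<le> t \<Longrightarrow> n s \<le> n t"
    and right_cont: "\<And>t. 0 \<le> t \<Longrightarrow> (n \<longlongrightarrow> n t) (at_right t)"
    and unit_jumps: "\<And>t. 0 < t \<Longrightarrow> eventually (\<lambda>s. n t \<le> n s + 1) (at_left t)"
begin

text \<open>The left limit \<open>n(t-)\<close>.\<close>

definition pre :: "real \<Rightarrow> nat" where
  "pre t = (if t \<in> jump_times n then n t - 1 else n t)"

lemma right_const: "0 \<le> t \<Longrightarrow> eventually (\<lambda>s. n s = n t) (at_right t)"
  using right_cont[of t] by (simp add: tendsto_discrete)

lemma jump_left:
  assumes "t \<in> jump_times n" "0 \<le> s" "s < t"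
  shows "n s < n t"
proof (rule ccontr)
  assume "\<not> n s < n t"
  then have "n v = n t" if "s < v" "v < t" for v
    using mono[of s v] mono[of v t] assms that by auto
  then have "eventually (\<lambda>v. n v = n t) (at_left t)"
    unfolding eventually_at_left_field using assms by blast
  with assms(1) show False by (simp add: jump_times_def tendsto_discrete)
qed

text \<open>At a jump, monotonicity forces \<open>n s < n t\<close> for all earlier
  \<open>s\<close>, while unit jumps force \<open>n t \<le> n s + 1\<close> close to
  \<open>t\<close>; together they pin \<open>n s\<close> to \<open>n t - 1\<close>.\<close>

lemma pre_left:
  assumes t: "0 < t"
  shows "eventually (\<lambda>s. n s = pre t) (at_left t)"
proof (cases "t \<in> jump_times n")
  case True
  show ?thesis
    using unit_jumps[OF t] eventually_at_left_real[OF t]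
  proof eventually_elim
    case (elim s)
    then show ?case using jump_left[OF True, of s] True by (simp add: pre_def)
  qed
next
  case False
  then show ?thesis using t by (simp add: jump_times_def pre_def tendsto_discrete)
qed

lemma n_eq_pre: "n t = pre t + (if t \<in> jump_times n then 1 else 0)"
proof (cases "t \<in> jump_times n")
  case True
  then have "0 < t" by (simp add: jump_times_def)
  \<comment> \<open>Comparison with time 0 gives \<open>n 0 < n t\<close>, so the natural-number
    subtraction in \<open>pre\<close> is not truncated.\<close>
  from jump_left[OF True order_refl this] True show ?thesis by (simp add: pre_def)
qed (simp add: pre_def)

lemma pre_0: "pre 0 = n 0"
  by (simp add: pre_def jump_times_def)

lemma no_jump:
  assumes "\<And>v. s < v \<Longrightarrow> v < t \<Longrightarrow> n v = k" "s < v" "v < t"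
  shows "v \<notin> jump_times n"
proof -
  have "eventually (\<lambda>u. n u = n v) (at_left v)"
    unfolding eventually_at_left_field using assms by (intro exI[of _ s]) auto
  then show ?thesis by (simp add: jump_times_def tendsto_discrete)
qed

lemma jumps_right:
  assumes t: "0 \<le> t"
  shows "eventually (\<lambda>s. jump_times n \<inter> {..s} = jump_times n \<inter> {..t}) (at_right t)"
proof -
  obtain u where u: "t < u" "\<And>v. t < v \<Longrightarrow> v < u \<Longrightarrow> n v = n t"
    using right_const[OF t] unfolding eventually_at_right_field by blast
  show ?thesis
    using eventually_at_right_real[OF u(1)]
  proof eventually_elim
    case (elim s)
    have "v \<le> t" if "v \<in> jump_times n" "v \<le> s" for v
    proof (rule ccontr)
      assume "\<not> v \<le> t"
      then have "t < v" "v < u" using that elim by auto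
      from no_jump[OF u(2) this] that(1) show False by simp
    qed
    with elim show ?case by auto
  qed
qed

lemma jumps_left:
  assumes t: "0 < t"
  shows "eventually (\<lambda>s. jump_times n \<inter> {..t} = (jump_times n \<inter> {..s}) \<union> (jump_times n \<inter> {t})) (at_left t)"
proof -
  obtain u where u: "u < t" "\<And>v. u < v \<Longrightarrow> v < t \<Longrightarrow> n v = pre t"
    using pre_left[OF t] unfolding eventually_at_left_field by blast
  show ?thesis
    using eventually_at_left_real[OF u(1)]
  proof eventually_elim
    case (elim s)
    have "v = t \<or> v \<le> s" if "v \<in> jump_times n" "v \<le> t" for v
    proof (rule ccontr)
      assume "\<not> (v = t \<or> v \<le> s)"
      then have "u < v" "v < t" using that elim by auto
      from no_jump[OF u(2) this] that(1) show False by simp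
    qed
    with elim show ?case by auto
  qed
qed

text \<open>Jump times do not accumulate: just to the left of \<open>t\<close> only \<open>t\<close>
  itself is added, and just to the right nothing is.\<close>

lemma finite_jumps: "finite (jump_times n \<inter> {..t})"
proof (cases "0 \<le> t")
  case True
  then show ?thesis
  proof (rule real_induction[rotated 3])
    show "finite (jump_times n \<inter> {..0})"
      by (rule finite_subset[of _ "{}"]) (auto simp: jump_times_def)
  next
    fix t :: real assume t: "0 < t" and IH: "\<And>s. 0 \<le> s \<Longrightarrow> s < t \<Longrightarrow> finite (jump_times n \<inter> {..s})"
    \<comment> \<open>The claim does not mention \<open>s\<close>; it follows outright because
      \<open>at_left t\<close> is a nontrivial filter.\<close>
    have "eventually (\<lambda>s. finite (jump_times n \<inter> {..t})) (at_left t)"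
      using jumps_left[OF t] eventually_at_left_real[OF t]
    proof eventually_elim
      case (elim s)
      then show ?case using IH[of s] by (metis finite_Int finite_Un finite.emptyI finite.insertI greaterThanLessThan_iff less_imp_le)
    qed
    then show "finite (jump_times n \<inter> {..t})" by simp
  next
    fix t :: real assume t: "0 \<le> t" and IH: "finite (jump_times n \<inter> {..t})"
    show "eventually (\<lambda>t. finite (jump_times n \<inter> {..t})) (at_right t)"
      using jumps_right[OF t] by eventually_elim (use IH in simp)
  qed
next
  case False
  then have "jump_times n \<inter> {..t} = {}" by (auto simp: jump_times_def)
  then show ?thesis by simp
qed

lemma sum_jumps_left:
  assumes t: "0 < t"
  shows "eventually (\<lambda>s. sum f (jump_times n \<inter> {..s})
    = sum f (jump_times n \<inter> {..t}) - (if t \<in> jump_times n then f t else 0 :: real)) (at_left t)"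
  using jumps_left[OF t] eventually_at_left_real[OF t]
proof eventually_elim
  case (elim s)
  have "sum f (jump_times n \<inter> {..t}) = sum f (jump_times n \<inter> {..s}) + sum f (jump_times n \<inter> {t})"
    unfolding elim(1) by (rule sum.union_disjoint) (use finite_jumps elim in auto)
  then show ?case by auto
qed

lemma cadlag_power:
  assumes "continuous_on {0..} g"
  shows "cadlag (\<lambda>t. g t * x ^ n t)"
    and "0 < t \<Longrightarrow> ((\<lambda>t. g t * x ^ n t) \<longlongrightarrow> g t * x ^ pre t) (at_left t)"
proof -
  have l: "((\<lambda>t. g t * x ^ n t) \<longlongrightarrow> g t * x ^ pre t) (at_left t)" if "0 < t" for t
  proof (rule Lim_transform_eventually)
    show "((\<lambda>s. g s * x ^ pre t) \<longlongrightarrow> g t * x ^ pre t) (at_left t)"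
      using that by (intro tendsto_intros continuous_on_atLeast_at_left[OF assms])
    show "eventually (\<lambda>s. g s * x ^ pre t = g s * x ^ n s) (at_left t)"
      using pre_left[OF that] by eventually_elim simp
  qed
  have r: "((\<lambda>t. g t * x ^ n t) \<longlongrightarrow> g t * x ^ n t) (at_right t)" if "0 \<le> t" for t
  proof (rule Lim_transform_eventually)
    show "((\<lambda>s. g s * x ^ n t) \<longlongrightarrow> g t * x ^ n t) (at_right t)"
      using that by (intro tendsto_intros continuous_on_atLeast_at_right[OF assms])
    show "eventually (\<lambda>s. g s * x ^ n t = g s * x ^ n s) (at_right t)"
      using right_const[OF that] by eventually_elim simp
  qed
  show "cadlag (\<lambda>t. g t * x ^ n t)" using l r by (auto simp: cadlag_def)
  show "0 < t \<Longrightarrow> ((\<lambda>t. g t * x ^ n t) \<longlongrightarrow> g t * x ^ pre t) (at_left t)" by (rule l)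
qed

lemma left_lim_power:
  assumes "continuous_on {0..} g" "0 \<le> t"
  shows "left_lim (\<lambda>t. g t * x ^ n t) t = g t * x ^ pre t"
  using cadlag_power(2)[OF assms(1), of t x] assms(2)
  by (auto simp: left_lim_def pre_0 intro!: tendsto_Lim)

text \<open>The jumps of \<open>A\<close> and of \<open>(1 + th) ^ n\<close> cancel in the quotient, which is therefore continuous, and
  its increments are compared with those of \<open>\<integral> c / D\<close>.\<close>

lemma linear_equation_unique:
  fixes A c :: "real \<Rightarrow> real" and a d th :: real
  defines "D \<equiv> \<lambda>t. exp (- d * t) * (1 + th) ^ n t"
  assumes n0: "n 0 = 0" and th: "th \<noteq> - 1"
    and c: "\<And>T. set_integrable lborel {0..T} c" and A: "cadlag A"
    and eq: "\<And>t. 0 \<le> t \<Longrightarrow> A t = a + (LINT s:{0..t}|lborel. c s - d * A s)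
               + (\<Sum>\<tau>\<in>jump_times n \<inter> {..t}. th * left_lim A \<tau>)"
    and t: "0 \<le> t"
  shows "set_integrable lborel {0..T} (\<lambda>s. c s / D s)"
    and "A t = D t * (a + (LINT s:{0..t}|lborel. c s / D s))"
proof -
  have D0: "D t \<noteq> 0" for t using th by (simp add: D_def)
  \<comment> \<open>The reciprocal of \<open>D\<close> has the same form, a continuous factor times
    a power of the counting path, so it is cadlag and locally bounded.\<close>
  have invD: "c t / D t = c t * (exp (d * t) * (1 / (1 + th)) ^ n t)" for t
    by (simp add: D_def exp_minus field_simps)
  have cD: "set_integrable lborel {0..T} (\<lambda>s. c s / D s)" for T
    unfolding invD by (intro set_integrable_mult_cadlag c cadlag_power continuous_intros)
  then show "set_integrable lborel {0..T} (\<lambda>s. c s / D s)" .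
  have cA: "set_integrable lborel {0..T} (\<lambda>s. c s - d * A s)" for T
    by (intro set_integral_diff c set_integrable_mult_right set_integrable_cadlag A)
  define E where "E = (\<lambda>t. A t / D t - a - (LINT s:{0..t}|lborel. c s / D s))"
  \<comment> \<open>The summand \<open>t\<close> absorbs the error from the drift term in
    \<open>A\<close>, the integral of \<open>\<bar>c\<bar>\<close> the error from the
    control.\<close>
  define w where "w = (\<lambda>t. t + (LINT s:{0..t}|lborel. \<bar>c s\<bar>))"
  have "E t = 0"
  proof (rule vanishing_increments[where w = w, OF _ _ _ _ t])
    have "jump_times n \<inter> {..0} = {}" by (auto simp: jump_times_def)
    with eq[of 0] show "E 0 = 0"
      using set_integral_singleton_lborel[of 0]
      by (simp add: E_def D_def n0 del: atLeastAtMost_singleton)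
  next
    fix t :: real assume t: "0 < t"
    show "(w \<longlongrightarrow> w t) (at_left t)"
      unfolding w_def using t
      by (intro continuous_on_atLeast_at_left continuous_intros set_integral_continuous set_integrable_abs c)
    obtain l where l: "(A \<longlongrightarrow> l) (at_left t)" using A t by (auto simp: cadlag_def)
    have ll: "left_lim A t = l" using t l by (auto simp: left_lim_def intro!: tendsto_Lim)
    define f where "f = (\<lambda>\<tau>. th * left_lim A \<tau>)"
    define j where "j = (if t \<in> jump_times n then 1 else 0::nat)"
    \<comment> \<open>Letting \<open>s\<close> increase to \<open>t\<close> in the equation loses
      exactly the jump at \<open>t\<close>. Hence \<open>A t\<close> is its left limit times
      \<open>(1 + th) ^ j\<close>, the same factor by which \<open>D\<close> jumps.\<close>
    have "(A \<longlongrightarrow> a + (LINT s:{0..t}|lborel. c s - d * A s)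
       + (sum f (jump_times n \<inter> {..t}) - (if t \<in> jump_times n then f t else 0))) (at_left t)"
    proof (rule Lim_transform_eventually)
      show "((\<lambda>s. a + (LINT v:{0..s}|lborel. c v - d * A v)
         + (sum f (jump_times n \<inter> {..t}) - (if t \<in> jump_times n then f t else 0)))
         \<longlongrightarrow> a + (LINT s:{0..t}|lborel. c s - d * A s)
         + (sum f (jump_times n \<inter> {..t}) - (if t \<in> jump_times n then f t else 0))) (at_left t)"
        by (intro tendsto_intros continuous_on_atLeast_at_left[OF set_integral_continuous] cA t)
      show "eventually (\<lambda>s. a + (LINT v:{0..s}|lborel. c v - d * A v)
         + (sum f (jump_times n \<inter> {..t}) - (if t \<in> jump_times n then f t else 0)) = A s) (at_left t)"
        using sum_jumps_left[OF t, of f] eventually_at_left_real[OF t]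
        by eventually_elim (simp add: eq f_def)
    qed
    with l have "l = a + (LINT s:{0..t}|lborel. c s - d * A s)
       + (sum f (jump_times n \<inter> {..t}) - (if t \<in> jump_times n then f t else 0))"
      using tendsto_unique trivial_limit_at_left_real by blast
    then have At: "A t = l * (1 + th) ^ j"
      using eq[of t] t ll by (auto simp: j_def f_def algebra_simps)
    have "(D \<longlongrightarrow> exp (- d * t) * (1 + th) ^ pre t) (at_left t)"
      unfolding D_def using t by (intro cadlag_power continuous_intros)
    then have "((\<lambda>t. A t / D t) \<longlongrightarrow> l / (exp (- d * t) * (1 + th) ^ pre t)) (at_left t)"
      using th by (intro tendsto_divide l) auto
    also have "l / (exp (- d * t) * (1 + th) ^ pre t) = A t / D t"
      using th by (simp add: At D_def n_eq_pre[of t] power_add j_def)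
    finally have lim: "((\<lambda>t. A t / D t) \<longlongrightarrow> A t / D t) (at_left t)" .
    show "(E \<longlongrightarrow> E t) (at_left t)"
      unfolding E_def by (intro tendsto_diff tendsto_const lim continuous_on_atLeast_at_left[OF set_integral_continuous] cD t)
  next
    fix t e :: real assume t: "0 \<le> t" and e: "0 < e"
    define k where "k = (1 + th) ^ n t"
    have k: "k \<noteq> 0" using th by (simp add: k_def)
    define p where "p = (\<lambda>v. exp (d * v))"
    have p0: "0 < p v" for v by (simp add: p_def)
    \<comment> \<open>Here \<open>\<bar>A t\<bar> + 1\<close> bounds \<open>\<bar>A u\<bar>\<close>,
      the term \<open>2 * p t\<close> comes from \<open>\<bar>A u - A v\<bar> \<le> 2 * h\<close>,
      and the leading 1 pays for the control term. The choice of \<open>h\<close> then makes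
      \<open>h * L\<close> at most \<open>e * \<bar>k\<bar>\<close>.\<close>
    define L where "L = 1 + \<bar>d\<bar> * (\<bar>A t\<bar> + 1 + 2 * p t)"
    have L: "1 \<le> L" unfolding L_def using p0[of t] by simp
    define h where "h = min 1 (e * \<bar>k\<bar> / L)"
    have h: "0 < h" "h \<le> 1" unfolding h_def using e k L by auto
    have hL: "h * L \<le> e * \<bar>k\<bar>"
    proof -
      have "h * L \<le> e * \<bar>k\<bar> / L * L" unfolding h_def using L by (intro mult_right_mono) auto
      then show ?thesis using L by simp
    qed
    have "(A \<longlongrightarrow> A t) (at_right t)" using A t by (auto simp: cadlag_def)
    then have "eventually (\<lambda>v. dist (A v) (A t) < h) (at_right t)" using h by (intro tendstoD) auto
    moreover have "(p \<longlongrightarrow> p t) (at_right t)"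
      unfolding p_def by (intro tendsto_intros)
    then have "eventually (\<lambda>v. dist (p v) (p t) < h) (at_right t)" using h by (intro tendstoD) auto
    moreover note right_const[OF t] jumps_right[OF t]
    ultimately have "eventually (\<lambda>v. \<bar>A v - A t\<bar> < h \<and> \<bar>p v - p t\<bar> < h \<and> n v = n t \<and>
        jump_times n \<inter> {..v} = jump_times n \<inter> {..t}) (at_right t)"
      by eventually_elim (simp add: dist_real_def)
    then obtain r where r: "t < r" and close: "\<And>v. t < v \<Longrightarrow> v < r \<Longrightarrow> \<bar>A v - A t\<bar> < h \<and> \<bar>p v - p t\<bar> < h \<and>
        n v = n t \<and> jump_times n \<inter> {..v} = jump_times n \<inter> {..t}"
      unfolding eventually_at_right_field by blast
    show "eventually (\<lambda>u. \<bar>E u - E t\<bar> \<le> e * (w u - w t)) (at_right t)"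
      using eventually_at_right_real[OF r]
    proof eventually_elim
      case (elim u)
      then have u: "t < u" "u < r" "0 \<le> u" "t \<le> u" using t by auto
      have sub: "set_integrable lborel {t..u} f" if "set_integrable lborel {0..u} f" for f :: "real \<Rightarrow> real"
        by (rule set_integrable_subset[OF that]) (use t in auto)
      have pc: "continuous_on S p" for S unfolding p_def by (intro continuous_intros)
      have ci: "set_integrable lborel {t..u} c" by (rule sub[OF c])
      have Ai: "set_integrable lborel {t..u} A" by (rule sub[OF set_integrable_cadlag[OF A]])
      have cpi: "set_integrable lborel {t..u} (\<lambda>v. c v * p v)"
        by (rule set_integrable_mult_continuous[OF ci pc])
      have pi: "set_integrable lborel {t..u} p"
        using set_integrable_mult_continuous[OF set_integrable_const[of t u 1] pc] by simp
      have Aut: "A u - A t = (LINT v:{t..u}|lborel. c v - d * A v)"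
        using eq[OF t] eq[OF u(3)] close[OF u(1,2)] set_integral_split[OF cA t u(4)] by simp
      have put: "p u - p t = (LINT v:{t..u}|lborel. d * p v)"
      proof -
        have "(LINT v:{t..u}|lborel. d * p v) = p u - p t"
          unfolding set_lebesgue_integral_def
        proof (rule integral_FTC_Icc[OF u(4)])
          fix x show "(p has_vector_derivative d * p x) (at x within {t..u})"
            unfolding p_def has_real_derivative_iff_has_vector_derivative[symmetric]
            by (auto intro!: derivative_eq_intros)
        qed (intro continuous_intros pc)
        then show ?thesis by simp
      qed
      have cDut: "(LINT v:{t..u}|lborel. c v / D v) = (LINT v:{t..u}|lborel. c v * p v) / k"
      proof -
        have "(LINT v:{t..u}|lborel. c v / D v) = (LINT v:{t..u}|lborel. c v * p v / k)"
        proof (rule set_lebesgue_integral_cong)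
          show "\<forall>v. v \<in> {t..u} \<longrightarrow> c v / D v = c v * p v / k"
          proof (intro allI impI)
            fix v assume "v \<in> {t..u}"
            then have "n v = n t" using close[of v] u by (cases "v = t") auto
            then have "D v = k / p v" by (simp add: D_def k_def p_def exp_minus field_simps)
            then show "c v / D v = c v * p v / k" by simp
          qed
        qed simp
        then show ?thesis by simp
      qed
      have nut: "n u = n t" using close[OF u(1,2)] by simp
      \<comment> \<open>No jump occurs in the interval, so \<open>D\<close> equals
        \<open>k / p\<close> there and \<open>k\<close> clears the constant. The product increment
        of \<open>p * A\<close> is then split, and each factor is replaced by the integral of its
        own equation; the resulting integrand would vanish if all its arguments were frozen at one
        time.\<close>
      have "k * (E u - E t) = p u * A u - p t * A t - (LINT v:{t..u}|lborel. c v * p v)"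
        using k set_integral_split[OF cD t u(4)]
        unfolding E_def cDut by (simp add: D_def nut p_def exp_minus field_simps flip: k_def)
      also have "p u * A u - p t * A t = (p u - p t) * A u + p t * (A u - A t)"
        by (simp add: algebra_simps)
      also have "(p u - p t) * A u + p t * (A u - A t) - (LINT v:{t..u}|lborel. c v * p v)
         = (LINT v:{t..u}|lborel. d * p v * A u + p t * (c v - d * A v) - c v * p v)"
        unfolding Aut put
        by (subst set_integral_diff set_integral_add; (intro set_integral_diff set_integral_add
              set_integrable_mult_right set_integrable_mult_left ci Ai pi cpi)?; simp)+
      finally have "\<bar>k * (E u - E t)\<bar> = \<bar>LINT v:{t..u}|lborel. d * p v * A u + p t * (c v - d * A v) - c v * p v\<bar>"
        by simp
      also have "\<dots> \<le> (LINT v:{t..u}|lborel. e * \<bar>k\<bar> * (1 + \<bar>c v\<bar>))"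
      proof (rule abs_set_integral_le)
        fix v assume v: "t < v" "v \<le> u"
        then have cv: "\<bar>A v - A t\<bar> < h" "\<bar>p v - p t\<bar> < h" using close[of v] u by auto
        have cu: "\<bar>A u - A t\<bar> < h" using close[OF u(1,2)] by simp
        have "d * p v * A u + p t * (c v - d * A v) - c v * p v
            = (p t - p v) * c v + d * ((p v - p t) * A u + p t * (A u - A v))"
          by (simp add: algebra_simps)
        also have "\<bar>\<dots>\<bar> \<le> \<bar>p t - p v\<bar> * \<bar>c v\<bar> + \<bar>d\<bar> * (\<bar>p v - p t\<bar> * \<bar>A u\<bar> + p t * \<bar>A u - A v\<bar>)"
        proof -
          have "\<bar>(p v - p t) * A u + p t * (A u - A v)\<bar> \<le> \<bar>p v - p t\<bar> * \<bar>A u\<bar> + p t * \<bar>A u - A v\<bar>"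
            using abs_triangle_ineq[of "(p v - p t) * A u" "p t * (A u - A v)"] p0[of t]
            by (simp add: abs_mult)
          from mult_left_mono[OF this abs_ge_zero[of d]]
          show ?thesis
            using abs_triangle_ineq[of "(p t - p v) * c v" "d * ((p v - p t) * A u + p t * (A u - A v))"]
            by (simp add: abs_mult)
        qed
        also have "\<dots> \<le> h * \<bar>c v\<bar> + \<bar>d\<bar> * (h * (\<bar>A t\<bar> + 1) + p t * (2 * h))"
        proof -
          have "\<bar>p v - p t\<bar> * \<bar>A u\<bar> \<le> h * (\<bar>A t\<bar> + 1)"
            using cv cu h by (intro mult_mono) auto
          moreover have "p t * \<bar>A u - A v\<bar> \<le> p t * (2 * h)"
            by (rule mult_left_mono) (use cv cu p0[of t] in linarith)+
          ultimately have "\<bar>d\<bar> * (\<bar>p v - p t\<bar> * \<bar>A u\<bar> + p t * \<bar>A u - A v\<bar>)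
              \<le> \<bar>d\<bar> * (h * (\<bar>A t\<bar> + 1) + p t * (2 * h))"
            by (rule mult_left_mono[OF add_mono abs_ge_zero])
          moreover have "\<bar>p t - p v\<bar> * \<bar>c v\<bar> \<le> h * \<bar>c v\<bar>"
            using cv by (intro mult_right_mono) auto
          ultimately show ?thesis by linarith
        qed
        also have "\<dots> \<le> h * (L * \<bar>c v\<bar>) + h * L"
        proof (rule add_mono)
          show "h * \<bar>c v\<bar> \<le> h * (L * \<bar>c v\<bar>)"
            using h L mult_right_mono[OF L, of "\<bar>c v\<bar>"] by (intro mult_left_mono) auto
          show "\<bar>d\<bar> * (h * (\<bar>A t\<bar> + 1) + p t * (2 * h)) \<le> h * L"
            using h by (simp add: L_def algebra_simps)
        qed
        also have "\<dots> = (h * L) * (1 + \<bar>c v\<bar>)" by (simp add: algebra_simps)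
        also have "\<dots> \<le> (e * \<bar>k\<bar>) * (1 + \<bar>c v\<bar>)" using hL by (intro mult_right_mono) auto
        finally show "\<bar>d * p v * A u + p t * (c v - d * A v) - c v * p v\<bar> \<le> e * \<bar>k\<bar> * (1 + \<bar>c v\<bar>)" .
      qed (intro set_integral_diff set_integral_add set_integrable_mult_right
             set_integrable_mult_left ci Ai pi cpi set_integrable_const set_integrable_abs)+
      also have "\<dots> = e * \<bar>k\<bar> * (w u - w t)"
      proof -
        have "(LINT v:{t..u}|lborel. 1 + \<bar>c v\<bar>) = (u - t) + (LINT v:{t..u}|lborel. \<bar>c v\<bar>)"
        proof -
          have "(LINT v:{t..u}|lborel. 1 + \<bar>c v\<bar>) = (LINT v:{t..u}|lborel. 1) + (LINT v:{t..u}|lborel. \<bar>c v\<bar>)"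
            by (intro set_integral_add set_integrable_const set_integrable_abs ci)
          also have "(LINT v:{t..u}|lborel. 1) = u - t"
            using u by (simp add: set_lebesgue_integral_def)
          finally show ?thesis .
        qed
        then show ?thesis using set_integral_split[OF set_integrable_abs[OF c] t u(4)]
          by (simp add: w_def)
      qed
      finally have "\<bar>k\<bar> * \<bar>E u - E t\<bar> \<le> \<bar>k\<bar> * (e * (w u - w t))" by (simp only: abs_mult mult_ac)
      then show ?case using k by simp
    qed
  qed
  then show "A t = D t * (a + (LINT s:{0..t}|lborel. c s / D s))"
    using D0[of t] by (simp add: E_def field_simps)
qed

text \<open>The control reads \<open>pre\<close> and the state reads \<open>n\<close>; these differ
  only at the finitely many jump times up to \<open>t\<close>, so under the integral
  \<open>c - d * A\<close> may be replaced by \<open>(k - d) * A\<close>. At a jump,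
  \<open>A\<close> grows by \<open>th\<close> times its left limit.\<close>

lemma linear_feedback_solution:
  fixes a d k th :: real
  defines "A \<equiv> \<lambda>t. a * exp ((k - d) * t) * (1 + th) ^ n t"
  defines "c \<equiv> \<lambda>t. k * (a * exp ((k - d) * t) * (1 + th) ^ pre t)"
  assumes n0: "n 0 = 0" and t: "0 \<le> t"
  shows "A t = a + (LINT s:{0..t}|lborel. c s - d * A s)
               + (\<Sum>\<tau>\<in>jump_times n \<inter> {..t}. th * left_lim A \<tau>)"
proof -
  have contg: "continuous_on {0..} (\<lambda>t. a * exp ((k - d) * t))" by (intro continuous_intros)
  have A: "cadlag A" unfolding A_def by (rule cadlag_power[OF contg])
  have ll: "left_lim A t = a * exp ((k - d) * t) * (1 + th) ^ pre t" if "0 \<le> t" for t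
    unfolding A_def by (rule left_lim_power[OF contg that])
  have "(LINT s:{0..t}|lborel. c s - d * A s) = (LINT s:{0..t}|lborel. (k - d) * A s)"
    unfolding set_lebesgue_integral_def
  proof (rule integral_discrete_difference)
    show "countable (jump_times n \<inter> {..t})" using finite_jumps by (rule countable_finite)
  qed (auto simp: c_def A_def n_eq_pre algebra_simps split: split_indicator)
  moreover define E where "E = (\<lambda>t. A t - a - (LINT s:{0..t}|lborel. (k - d) * A s) - (\<Sum>\<tau>\<in>jump_times n \<inter> {..t}. th * left_lim A \<tau>))"
  have Ai: "set_integrable lborel {0..T} (\<lambda>s. (k - d) * A s)" for T
    by (intro set_integrable_mult_right set_integrable_cadlag A)
  have "E t = 0"
  \<comment> \<open>Right-hand increments of \<open>E\<close> vanish exactly, so the identity is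
    already a sufficient control function.\<close>
  proof (rule vanishing_increments[where w = "\<lambda>t. t", OF _ _ _ _ t])
    have "jump_times n \<inter> {..0} = {}" by (auto simp: jump_times_def)
    then show "E 0 = 0"
      using set_integral_singleton_lborel[of 0]
      by (simp add: E_def A_def n0 del: atLeastAtMost_singleton)
  next
    fix t :: real assume t: "0 < t"
    define f where "f = (\<lambda>\<tau>. th * left_lim A \<tau>)"
    show "(E \<longlongrightarrow> E t) (at_left t)"
    proof (rule Lim_transform_eventually)
      have "(A \<longlongrightarrow> A t - (if t \<in> jump_times n then f t else 0)) (at_left t)"
        using cadlag_power(2)[OF contg t, of "1 + th"] t
        by (auto simp: A_def[symmetric] f_def ll) (auto simp: A_def n_eq_pre algebra_simps)
      then have "((\<lambda>s. A s - a - (LINT v:{0..s}|lborel. (k - d) * A v)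
          - (sum f (jump_times n \<inter> {..t}) - (if t \<in> jump_times n then f t else 0)))
        \<longlongrightarrow> (A t - (if t \<in> jump_times n then f t else 0)) - a - (LINT v:{0..t}|lborel. (k - d) * A v)
          - (sum f (jump_times n \<inter> {..t}) - (if t \<in> jump_times n then f t else 0))) (at_left t)"
        by (intro tendsto_intros continuous_on_atLeast_at_left[OF set_integral_continuous] Ai t)
      then show "((\<lambda>s. A s - a - (LINT v:{0..s}|lborel. (k - d) * A v)
          - (sum f (jump_times n \<inter> {..t}) - (if t \<in> jump_times n then f t else 0))) \<longlongrightarrow> E t) (at_left t)"
        by (rule back_subst[where P = "\<lambda>y. (_ \<longlongrightarrow> y) _"]) (simp add: E_def f_def)
      show "eventually (\<lambda>s. A s - a - (LINT v:{0..s}|lborel. (k - d) * A v)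
          - (sum f (jump_times n \<inter> {..t}) - (if t \<in> jump_times n then f t else 0)) = E s) (at_left t)"
        using sum_jumps_left[OF t, of f] by eventually_elim (simp add: E_def f_def)
    qed
  next
    fix t e :: real assume t: "0 \<le> t" and e: "0 < e"
    obtain r where r: "t < r" "\<And>v. t < v \<Longrightarrow> v < r \<Longrightarrow> n v = n t \<and> jump_times n \<inter> {..v} = jump_times n \<inter> {..t}"
      using eventually_conj[OF right_const[OF t] jumps_right[OF t]]
      unfolding eventually_at_right_field by blast
    show "eventually (\<lambda>u. \<bar>E u - E t\<bar> \<le> e * (u - t)) (at_right t)"
      using eventually_at_right_real[OF r(1)]
    proof eventually_elim
      case (elim u)
      then have u: "t < u" "u < r" "t \<le> u" by auto
      define g where "g = (\<lambda>v. a * exp ((k - d) * v) * (1 + th) ^ n t)"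
      have Ag: "A v = g v" if "v \<in> {t..u}" for v
        using r(2)[of v] that u by (cases "v = t") (auto simp: A_def g_def)
      have "(LINT v:{t..u}|lborel. (k - d) * A v) = (LINT v:{t..u}|lborel. (k - d) * g v)"
        by (rule set_lebesgue_integral_cong) (auto simp: Ag)
      also have "\<dots> = g u - g t"
        unfolding set_lebesgue_integral_def
      proof (rule integral_FTC_Icc[OF u(3)])
        fix x show "(g has_vector_derivative (k - d) * g x) (at x within {t..u})"
          unfolding g_def has_real_derivative_iff_has_vector_derivative[symmetric]
          by (auto intro!: derivative_eq_intros)
      qed (auto intro!: continuous_intros simp: g_def)
      also have "\<dots> = A u - A t" using u by (simp add: Ag)
      finally have "E u - E t = 0"
        using set_integral_split[OF Ai t u(3)] r(2)[OF u(1,2)] by (simp add: E_def)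
      then show ?case using e u by simp
    qed
  qed (auto intro!: tendsto_intros)
  ultimately show ?thesis by (simp add: E_def)
qed

end

section \<open>Poisson filtrations\<close>

context poisson_filtered_space
begin

section \<open>Independent increments and the exponential martingale\<close>

lemma subalgebra_F: "0 \<le> t \<Longrightarrow> subalgebra M (F t)"
  using sets_F_subset[of t] by (simp add: subalgebra_def space_F)

lemma measurable_N: "0 \<le> t \<Longrightarrow> N t \<in> M \<rightarrow>\<^sub>M count_space UNIV"
  by (rule measurable_from_subalg[OF subalgebra_F N_adapted])

lemma counting_path: "x \<in> space M \<Longrightarrow> counting_path (\<lambda>t. N t x)"
  using N_mono N_right_cont N_unit_jumps by unfold_locales auto

text \<open>Independence is postulated for events only; induction over indicators, sums and monotone
  limits extends it to nonnegative \<open>F s\<close>-measurable factors.\<close>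

lemma nn_integral_indep_increment:
  fixes B :: "nat set"
  assumes H: "H \<in> borel_measurable (F s)" and st: "0 \<le> s" "s \<le> t"
  defines "E \<equiv> {x \<in> space M. N t x - N s x \<in> B}"
  shows "(\<integral>\<^sup>+x. H x * indicator E x \<partial>M) = (\<integral>\<^sup>+x. H x \<partial>M) * emeasure M E"
proof -
  have "0 \<le> t" using st by simp
  note [measurable] = measurable_N[OF st(1)] measurable_N[OF this]
  have E[measurable]: "E \<in> sets M" unfolding E_def by measurable
  have M: "f \<in> borel_measurable M" if "f \<in> borel_measurable (F s)" for f :: "'a \<Rightarrow> ennreal"
    by (rule measurable_from_subalg[OF subalgebra_F[OF st(1)] that])
  show ?thesis
    using H
  proof (induction rule: borel_measurable_induct)
    case (cong f g)
    have f: "(\<integral>\<^sup>+x. f x * indicator E x \<partial>M) = (\<integral>\<^sup>+x. g x * indicator E x \<partial>M)"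
      "(\<integral>\<^sup>+x. f x \<partial>M) = (\<integral>\<^sup>+x. g x \<partial>M)"
      by (rule nn_integral_cong, simp add: cong space_F)+
    show ?case unfolding f by (rule cong(4))
  next
    case (set A)
    then have A: "A \<in> sets M" using sets_F_subset[OF st(1)] by auto
    have "prob (A \<inter> E) = prob A * prob E"
      using indep_setD[OF N_increment_indep[OF st] set] by (auto simp: E_def)
    then show ?case
      using A E by (simp add: indicator_inter_arith[symmetric] emeasure_eq_measure ennreal_mult)
  next
    case (mult u v)
    then show ?case using M[OF \<open>u \<in> borel_measurable (F s)\<close>] by (simp add: nn_integral_cmult mult.assoc)
  next
    case (add u v)
    then show ?case
      using M[OF \<open>u \<in> borel_measurable (F s)\<close>] M[OF \<open>v \<in> borel_measurable (F s)\<close>] by (simp add: nn_integral_add distrib_right)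
  next
    case (seq U)
    have U: "U i \<in> borel_measurable M" for i using M[OF seq(1)] .
    have inc: "incseq (\<lambda>i x. U i x * indicator E x)"
      using seq(3) by (auto simp: incseq_def le_fun_def intro!: mult_right_mono)
    have "(\<integral>\<^sup>+x. (SUP i. U i) x * indicator E x \<partial>M) = (\<integral>\<^sup>+x. (SUP i. U i x * indicator E x) \<partial>M)"
      by (simp add: SUP_mult_right_ennreal[symmetric] SUP_apply image_comp)
    also have "\<dots> = (SUP i. (\<integral>\<^sup>+x. U i x * indicator E x \<partial>M))"
      using U inc by (intro nn_integral_monotone_convergence_SUP) auto
    also have "\<dots> = (SUP i. (\<integral>\<^sup>+x. U i x \<partial>M)) * emeasure M E"
      using seq by (simp add: SUP_mult_right_ennreal)
    also have "(SUP i. (\<integral>\<^sup>+x. U i x \<partial>M)) = (\<integral>\<^sup>+x. (SUP i. U i) x \<partial>M)"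
      using nn_integral_monotone_convergence_SUP[of U M] U seq(3) by (simp add: SUP_apply image_comp)
    finally show ?case .
  qed
qed

text \<open>Conditioning on the value of the increment produces the generating function of the
  Poisson law, \<open>exp (m * (z - 1))\<close> with \<open>m = lam * (t - s)\<close>.\<close>

lemma nn_integral_increment_power:
  assumes H: "H \<in> borel_measurable (F s)" and st: "0 \<le> s" "s \<le> t" and z: "0 \<le> z"
  shows "(\<integral>\<^sup>+x. H x * ennreal (z ^ (N t x - N s x)) \<partial>M)
    = (\<integral>\<^sup>+x. H x \<partial>M) * ennreal (exp (lam * (t - s) * (z - 1)))"
proof -
  have "0 \<le> t" using st by simp
  note [measurable] = measurable_N[OF st(1)] measurable_N[OF this]
  define E where "E = (\<lambda>k. {x \<in> space M. N t x - N s x = k})"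
  have E[measurable]: "E k \<in> sets M" for k unfolding E_def by measurable
  have HM[measurable]: "H \<in> borel_measurable M"
    by (rule measurable_from_subalg[OF subalgebra_F[OF st(1)] H])
  define m where "m = lam * (t - s)"
  have m: "0 \<le> m" unfolding m_def using intensity_nonneg st by simp
  have "(\<integral>\<^sup>+x. H x * ennreal (z ^ (N t x - N s x)) \<partial>M)
      = (\<integral>\<^sup>+x. (\<Sum>k. ennreal (z ^ k) * (H x * indicator (E k) x)) \<partial>M)"
  proof (rule nn_integral_cong)
    fix x assume x: "x \<in> space M"
    have "(\<Sum>k. ennreal (z ^ k) * (H x * indicator (E k) x))
        = (\<Sum>k\<in>{N t x - N s x}. ennreal (z ^ k) * (H x * indicator (E k) x))"
      by (rule suminf_finite) (auto simp: E_def)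
    then show "H x * ennreal (z ^ (N t x - N s x)) = (\<Sum>k. ennreal (z ^ k) * (H x * indicator (E k) x))"
      using x by (simp add: E_def mult.commute)
  qed
  also have "\<dots> = (\<Sum>k. ennreal (z ^ k) * (\<integral>\<^sup>+x. H x * indicator (E k) x \<partial>M))"
    by (simp add: nn_integral_suminf nn_integral_cmult)
  also have "\<dots> = (\<Sum>k. (\<integral>\<^sup>+x. H x \<partial>M) * ennreal (z ^ k * (m ^ k / fact k * exp (- m))))"
  proof (rule suminf_cong)
    fix k
    have "(\<integral>\<^sup>+x. H x * indicator (E k) x \<partial>M) = (\<integral>\<^sup>+x. H x \<partial>M) * ennreal (m ^ k / fact k * exp (- m))"
      using nn_integral_indep_increment[OF H st, of "{k}"] N_increment_law[OF st, of k]
      by (simp add: E_def emeasure_eq_measure m_def)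
    then show "ennreal (z ^ k) * (\<integral>\<^sup>+x. H x * indicator (E k) x \<partial>M)
        = (\<integral>\<^sup>+x. H x \<partial>M) * ennreal (z ^ k * (m ^ k / fact k * exp (- m)))"
      using z m by (subst ennreal_mult) (auto simp: mult_ac)
  qed
  also have "\<dots> = (\<integral>\<^sup>+x. H x \<partial>M) * (\<Sum>k. ennreal (z ^ k * (m ^ k / fact k * exp (- m))))"
    by simp
  also have "(\<Sum>k. ennreal (z ^ k * (m ^ k / fact k * exp (- m)))) = ennreal (exp (m * (z - 1)))"
  proof (rule suminf_ennreal_eq)
    have "(\<lambda>k. (z * m) ^ k /\<^sub>R fact k * exp (- m)) sums (exp (z * m) * exp (- m))"
      by (intro sums_mult2 exp_converges)
    then show "(\<lambda>k. z ^ k * (m ^ k / fact k * exp (- m))) sums exp (m * (z - 1))"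
      by (simp add: power_mult_distrib divide_inverse mult_ac exp_add[symmetric] algebra_simps)
  qed (use z m in auto)
  finally show ?thesis by (simp add: m_def)
qed

text \<open>The Doleans exponential of the compensated Poisson process; as a density it would change
  the intensity from \<open>lam\<close> to \<open>lam * z\<close>.\<close>

definition power_martingale :: "real \<Rightarrow> real \<Rightarrow> 'a \<Rightarrow> real" where
  "power_martingale z t x = z ^ N t x * exp (- (lam * (z - 1) * t))"

lemma power_martingale_nonneg: "0 \<le> z \<Longrightarrow> 0 \<le> power_martingale z t x" and power_martingale_pos: "0 < z \<Longrightarrow> 0 < power_martingale z t x"
  by (auto simp: power_martingale_def)

lemma power_martingale_measurable: "0 \<le> t \<Longrightarrow> power_martingale z t \<in> borel_measurable (F t)"
proof -
  assume "0 \<le> t"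
  note [measurable] = N_adapted[OF this]
  show ?thesis unfolding power_martingale_def by measurable
qed

text \<open>The martingale property in weak form, tested against nonnegative
  \<open>F s\<close>-measurable variables. No conditional expectations and no integrability of
  \<open>H\<close> are involved.\<close>

lemma power_martingale_step:
  assumes H: "H \<in> borel_measurable (F s)" and st: "0 \<le> s" "s \<le> t" and z: "0 \<le> z"
  shows "(\<integral>\<^sup>+x. H x * ennreal (power_martingale z t x) \<partial>M) = (\<integral>\<^sup>+x. H x * ennreal (power_martingale z s x) \<partial>M)"
proof -
  note [measurable] = power_martingale_measurable[OF st(1)] H
  have "0 \<le> t" using st by simp
  \<comment> \<open>The value at time \<open>s\<close> is absorbed into the test variable, so that
    only the power of the increment remains to be averaged.\<close>
  have HZ: "(\<lambda>x. H x * ennreal (power_martingale z s x)) \<in> borel_measurable (F s)" by measurable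
  note meas = measurable_N[OF st(1)] measurable_N[OF \<open>0 \<le> t\<close>]
    measurable_from_subalg[OF subalgebra_F[OF st(1)] HZ]
  define e where "e = lam * (t - s) * (z - 1)"
  have "(\<integral>\<^sup>+x. H x * ennreal (power_martingale z t x) \<partial>M)
      = (\<integral>\<^sup>+x. H x * ennreal (power_martingale z s x) * ennreal (z ^ (N t x - N s x)) * ennreal (exp (- e)) \<partial>M)"
  proof (rule nn_integral_cong)
    fix x assume x: "x \<in> space M"
    have "z ^ N t x = z ^ N s x * z ^ (N t x - N s x)"
      using N_mono[OF x st] by (simp flip: power_add)
    moreover have "exp (- (lam * (z - 1) * t)) = exp (- (lam * (z - 1) * s)) * exp (- e)"
      by (simp add: e_def algebra_simps flip: exp_add)
    ultimately have "power_martingale z t x = power_martingale z s x * z ^ (N t x - N s x) * exp (- e)"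
      by (simp add: power_martingale_def)
    then show "H x * ennreal (power_martingale z t x)
        = H x * ennreal (power_martingale z s x) * ennreal (z ^ (N t x - N s x)) * ennreal (exp (- e))"
      using z power_martingale_nonneg[OF z] by (simp add: ennreal_mult mult.assoc)
  qed
  also have "\<dots> = (\<integral>\<^sup>+x. H x * ennreal (power_martingale z s x) * ennreal (z ^ (N t x - N s x)) \<partial>M) * ennreal (exp (- e))"
  proof (intro nn_integral_multc borel_measurable_times_ennreal[OF meas(3)])
    show "(\<lambda>x. ennreal (z ^ (N t x - N s x))) \<in> borel_measurable M"
      using meas(1,2) by measurable
  qed
  also have "\<dots> = (\<integral>\<^sup>+x. H x * ennreal (power_martingale z s x) \<partial>M) * ennreal (exp e) * ennreal (exp (- e))"
    by (simp add: nn_integral_increment_power[OF HZ st z] e_def)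
  also have "\<dots> = (\<integral>\<^sup>+x. H x * ennreal (power_martingale z s x) \<partial>M)"
    by (simp add: mult.assoc flip: ennreal_mult exp_add)
  finally show ?thesis .
qed

lemma power_martingale_expectation:
  assumes "0 \<le> t" "0 \<le> z"
  shows "(\<integral>\<^sup>+x. ennreal (power_martingale z t x) \<partial>M) = 1"
proof -
  have "(\<integral>\<^sup>+x. ennreal (power_martingale z t x) \<partial>M) = (\<integral>\<^sup>+x. ennreal (power_martingale z 0 x) \<partial>M)"
    using power_martingale_step[of "\<lambda>_. 1" 0 t z] assms by simp
  also have "\<dots> = (\<integral>\<^sup>+x. 1 \<partial>M)"
    by (rule nn_integral_cong) (simp add: power_martingale_def N_start)
  finally show ?thesis by (simp add: emeasure_space_1)
qed

section \<open>Joint measurability and predictability\<close>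

lemma power_N_joint_measurable:
  "(\<lambda>(t, x). indicator {0..} t * (y::real) ^ N t x) \<in> borel_measurable (borel \<Otimes>\<^sub>M M)"
proof (rule measurable_right_continuous_pair)
  fix t :: real assume "0 \<le> t"
  note [measurable] = measurable_N[OF this]
  show "(\<lambda>x. y ^ N t x) \<in> borel_measurable M" by measurable
next
  fix t :: real and x assume t: "0 \<le> t" and x: "x \<in> space M"
  interpret counting_path "\<lambda>t. N t x" by (rule counting_path[OF x])
  show "((\<lambda>s. y ^ N s x) \<longlongrightarrow> y ^ N t x) (at_right t)"
    by (rule tendsto_eventually) (use right_const[OF t] in \<open>auto elim: eventually_mono\<close>)
qed

lemma F_into_space: "B \<in> sets (F s) \<Longrightarrow> B \<subseteq> space M"
  using sets.sets_into_space[of B "F s"] by (simp add: space_F)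

lemma predictable_generators_subset:
  "{{0} \<times> B |B. B \<in> sets (F 0)} \<union>
   {{s<..t} \<times> B |s t B. 0 \<le> s \<and> s \<le> t \<and> B \<in> sets (F s)} \<subseteq> Pow ({0..} \<times> space M)"
  using F_into_space by auto

lemma space_predictable: "space (predictable_sigma M F) = {0..} \<times> space M"
  and sets_predictable: "sets (predictable_sigma M F) = sigma_sets ({0..} \<times> space M)
     ({{0} \<times> B |B. B \<in> sets (F 0)} \<union>
      {{s<..t} \<times> B |s t B. 0 \<le> s \<and> s \<le> t \<and> B \<in> sets (F s)})"
proof -
  show "space (predictable_sigma M F) = {0..} \<times> space M"
    "sets (predictable_sigma M F) = sigma_sets ({0..} \<times> space M)
     ({{0} \<times> B |B. B \<in> sets (F 0)} \<union>
      {{s<..t} \<times> B |s t B. 0 \<le> s \<and> s \<le> t \<and> B \<in> sets (F s)})"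
    using predictable_generators_subset by (auto simp: predictable_sigma_def)
qed

text \<open>Predictable processes are adapted: the slice of a generator
  \<open>{s<..u} \<times> B\<close> at time \<open>t\<close> is empty unless \<open>s < t\<close>,
  and then \<open>B\<close> belongs to \<open>F t\<close>.\<close>

lemma predictable_section:
  assumes f: "(\<lambda>(t, x). f t x) \<in> borel_measurable (predictable_sigma M F)" and t: "0 \<le> t"
  shows "f t \<in> borel_measurable (F t)"
proof -
  have "(\<lambda>x. (t, x)) \<in> F t \<rightarrow>\<^sub>M predictable_sigma M F"
  proof (rule measurable_sigma_sets[OF sets_predictable])
    show "(\<lambda>x. (t, x)) \<in> space (F t) \<rightarrow> {0..} \<times> space M" using t by (auto simp: space_F)
    fix S assume "S \<in> {{0} \<times> B |B. B \<in> sets (F 0)} \<union>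
      {{s<..t} \<times> B |s t B. 0 \<le> s \<and> s \<le> t \<and> B \<in> sets (F s)}"
    then consider B where "S = {0} \<times> B" "B \<in> sets (F 0)"
      | s u B where "S = {s<..u} \<times> B" "0 \<le> s" "B \<in> sets (F s)" by blast
    then show "(\<lambda>x. (t, x)) -` S \<inter> space (F t) \<in> sets (F t)"
    proof cases
      case 1
      then have "B \<in> sets (F t)" using sets_F_mono[OF t] by auto
      moreover have "(\<lambda>x. (t, x)) -` S \<inter> space (F t) = (if t = 0 then B \<inter> space (F t) else {})"
        using 1 by auto
      ultimately show ?thesis by auto
    next
      case 2
      have "B \<in> sets (F t)" if "s < t" using sets_F_mono[of s t] that 2 by auto
      moreover have "(\<lambda>x. (t, x)) -` S \<inter> space (F t) = (if s < t \<and> t \<le> u then B \<inter> space (F t) else {})"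
        using 2 by auto
      ultimately show ?thesis by auto
    qed
  qed (rule predictable_generators_subset)
  from measurable_compose[OF this f] show ?thesis by simp
qed

lemma predictable_joint_measurable:
  assumes f: "(\<lambda>(t, x). f t x) \<in> borel_measurable (predictable_sigma M F)"
  shows "(\<lambda>(t, x). indicator {0..} t * (f t x :: real)) \<in> borel_measurable (borel \<Otimes>\<^sub>M M)"
proof -
  \<comment> \<open>The predictable sigma-algebra lives on nonnegative times only, so the comparison
    is made there and the process is extended by 0 afterwards.\<close>
  define R where "R = restrict_space (borel \<Otimes>\<^sub>M M) ({0..} \<times> space M :: (real \<times> 'a) set)"
  have S: "{0..} \<times> space M \<in> sets (borel \<Otimes>\<^sub>M M :: (real \<times> 'a) measure)" by simp
  have "(\<lambda>p. p) \<in> R \<rightarrow>\<^sub>M predictable_sigma M F"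
  proof (rule measurable_sigma_sets[OF sets_predictable])
    show "(\<lambda>p. p) \<in> space R \<rightarrow> {0..} \<times> space M" by (auto simp: R_def space_restrict_space)
    fix S' assume "S' \<in> {{0} \<times> B |B. B \<in> sets (F 0)} \<union>
      {{s<..t} \<times> B |s t B. 0 \<le> s \<and> s \<le> t \<and> B \<in> sets (F s)}"
    then consider B where "S' = {0} \<times> B" "B \<in> sets (F 0)"
      | s u B where "S' = {s<..u} \<times> B" "0 \<le> s" "B \<in> sets (F s)" by blast
    then have "S' \<in> sets (borel \<Otimes>\<^sub>M M)"
      by cases (use sets_F_subset in \<open>auto intro!: pair_measureI\<close>)
    then show "(\<lambda>p. p) -` S' \<inter> space R \<in> sets R"
      unfolding R_def using S by (auto simp: space_restrict_space sets_restrict_space_iff)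
  qed (rule predictable_generators_subset)
  from measurable_compose[OF this f]
  have "(\<lambda>(t, x). f t x) \<in> borel_measurable R" by simp
  then have "(\<lambda>p. indicator ({0..} \<times> space M) p *\<^sub>R (case p of (t, x) \<Rightarrow> f t x)) \<in> borel_measurable (borel \<Otimes>\<^sub>M M)"
    unfolding R_def using S by (subst (asm) borel_measurable_restrict_space_iff) auto
  then show ?thesis
    by (rule measurable_cong[THEN iffD1, rotated])
      (auto simp: space_pair_measure indicator_def)
qed

lemma predictable_Times:
  assumes "0 \<le> s" "B \<in> sets (F s)"
  shows "{s<..t} \<times> B \<in> sets (predictable_sigma M F)"
proof (cases "s \<le> t")
  case True
  then show ?thesis unfolding sets_predictable using assms by (intro sigma_sets.Basic) blast
qed simp

lemma predictable_Times_0: "B \<in> sets (F 0) \<Longrightarrow> {0} \<times> B \<in> sets (predictable_sigma M F)"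
  unfolding sets_predictable by (intro sigma_sets.Basic) blast

lemma predictable_fst: "fst \<in> borel_measurable (predictable_sigma M F)"
  unfolding borel_measurable_iff_le
proof
  fix b :: real
  have Om: "space M \<in> sets (F 0)" using sets.top[of "F 0"] by (simp add: space_F)
  have "{w \<in> space (predictable_sigma M F). fst w \<le> b}
      = (if b < 0 then {} else {0} \<times> space M \<union> {0<..b} \<times> space M)"
    by (auto simp: space_predictable)
  then show "{w \<in> space (predictable_sigma M F). fst w \<le> b} \<in> sets (predictable_sigma M F)"
    using predictable_Times[OF order_refl Om] predictable_Times_0[OF Om] by auto
qed

text \<open>The left limit is the limit of \<open>N\<close> sampled at the last grid point strictly
  before \<open>t\<close>. Each sample is constant in time on \<open>(j/(k+1), (j+1)/(k+1)]\<close>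
  and known at the left endpoint, so it is built from predictable rectangles.\<close>

lemma predictable_pre:
  "(\<lambda>(t, x). (y::real) ^ counting_path.pre (\<lambda>s. N s x) t) \<in> borel_measurable (predictable_sigma M F)"
proof (rule borel_measurable_LIMSEQ_real)
  \<comment> \<open>Ceiling minus one, not floor, keeps the grid point strictly below
    \<open>t\<close> when \<open>t\<close> is on the grid. At \<open>t = 0\<close> the conversion
    \<open>nat\<close> turns -1 into index 0.\<close>
  define i where "i = (\<lambda>(k::nat) (t::real). nat (\<lceil>real (Suc k) * t\<rceil> - 1))"
  define r where "r = (\<lambda>k t. real (i k t) / real (Suc k))"
  have i_iff: "i k t = j \<longleftrightarrow> t \<in> {real j / real (Suc k) <.. (real j + 1) / real (Suc k)} \<or> (j = 0 \<and> t = 0)"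
    if "0 \<le> t" for k t j
  proof -
    have *: "i k t = j \<longleftrightarrow> \<lceil>real (Suc k) * t\<rceil> = int j + 1 \<or> (j = 0 \<and> t = 0)"
    proof (cases "t = 0")
      case False
      then have "0 < real (Suc k) * t" using that by (intro mult_pos_pos) auto
      then have "1 \<le> \<lceil>real (Suc k) * t\<rceil>" by linarith
      with False show ?thesis by (auto simp: i_def)
    qed (auto simp: i_def)
    show ?thesis unfolding *
      by (simp add: ceiling_eq_iff pos_divide_less_eq pos_le_divide_eq mult.commute)
  qed
  show "(\<lambda>(t, x). y ^ N (r k t) x) \<in> borel_measurable (predictable_sigma M F)" for k
  proof -
    have "(\<lambda>(t, x). N (r k t) x) \<in> predictable_sigma M F \<rightarrow>\<^sub>M count_space UNIV"
    proof (rule measurable_count_space_eq2_countable[THEN iffD2], intro conjI ballI)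
      fix m :: nat
      define B where "B = (\<lambda>j. N (real j / real (Suc k)) -` {m} \<inter> space M)"
      have B: "B j \<in> sets (F (real j / real (Suc k)))" for j
        using measurable_sets[OF N_adapted, of "real j / real (Suc k)" "{m}"] by (simp add: B_def space_F)
      have "(\<lambda>(t, x). N (r k t) x) -` {m} \<inter> space (predictable_sigma M F)
          = {0} \<times> B 0 \<union> (\<Union>j. {real j / real (Suc k) <.. (real j + 1) / real (Suc k)} \<times> B j)"
      proof (intro set_eqI)
        fix w :: "real \<times> 'a"
        obtain t x where w: "w = (t, x)" by (cases w)
        have "w \<in> (\<lambda>(t, x). N (r k t) x) -` {m} \<inter> space (predictable_sigma M F)
            \<longleftrightarrow> 0 \<le> t \<and> (\<exists>j. i k t = j \<and> x \<in> B j)"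
          by (auto simp: w space_predictable B_def r_def)
        also have "\<dots> \<longleftrightarrow> 0 \<le> t \<and> (\<exists>j. (t \<in> {real j / real (Suc k) <.. (real j + 1) / real (Suc k)}
             \<or> (j = 0 \<and> t = 0)) \<and> x \<in> B j)"
          using i_iff by blast
        also have "\<dots> \<longleftrightarrow> (t = 0 \<and> x \<in> B 0) \<or> (\<exists>j. t \<in> {real j / real (Suc k) <.. (real j + 1) / real (Suc k)} \<and> x \<in> B j)"
        proof -
          have "0 \<le> t" if "t \<in> {real j / real (Suc k) <.. (real j + 1) / real (Suc k)}" for j
          proof -
            have "0 \<le> real j / real (Suc k)" by (rule divide_nonneg_nonneg) simp_all
            moreover have "real j / real (Suc k) < t" using that by (simp only: greaterThanAtMost_iff)
            ultimately show ?thesis by linarith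
          qed
          then show ?thesis by blast
        qed
        finally show "w \<in> (\<lambda>(t, x). N (r k t) x) -` {m} \<inter> space (predictable_sigma M F)
          \<longleftrightarrow> w \<in> {0} \<times> B 0 \<union> (\<Union>j. {real j / real (Suc k) <.. (real j + 1) / real (Suc k)} \<times> B j)"
          by (simp add: w)
      qed
      also have "\<dots> \<in> sets (predictable_sigma M F)"
        using B B[of 0] by (intro sets.Un sets.countable_UN predictable_Times_0 image_subsetI predictable_Times) auto
      finally show "(\<lambda>(t, x). N (r k t) x) -` {m} \<inter> space (predictable_sigma M F)
        \<in> sets (predictable_sigma M F)" .
    qed auto
    from measurable_compose[OF this, of "\<lambda>m. y ^ m" borel]
    show ?thesis by (simp add: case_prod_beta)
  qed
  fix w assume "w \<in> space (predictable_sigma M F)"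
  then obtain t x where w: "w = (t, x)" and t: "0 \<le> t" and x: "x \<in> space M"
    by (auto simp: space_predictable)
  interpret counting_path "\<lambda>t. N t x" by (rule counting_path[OF x])
  have "eventually (\<lambda>k. N (r k t) x = pre t) sequentially"
  proof (cases "t = 0")
    case True
    then show ?thesis by (simp add: r_def i_def pre_0)
  next
    case False
    then have t: "0 < t" using t by simp
    have lt: "r k t < t" and ge: "t - 1 / real (Suc k) \<le> r k t" for k
    proof -
      have "t \<in> {r k t <.. (real (i k t) + 1) / real (Suc k)}"
        using i_iff[of t k "i k t"] t by (simp add: r_def)
      then show "r k t < t" "t - 1 / real (Suc k) \<le> r k t"
        by (auto simp: r_def add_divide_distrib)
    qed
    have "(\<lambda>k. r k t) \<longlonglongrightarrow> t"
    proof (rule tendsto_sandwich[OF _ _ _ tendsto_const])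
      show "(\<lambda>k. t - 1 / real (Suc k)) \<longlonglongrightarrow> t"
        using tendsto_diff[OF tendsto_const[of t] LIMSEQ_inverse_real_of_nat]
        by (simp add: inverse_eq_divide)
    qed (use lt ge in \<open>auto intro!: always_eventually less_imp_le\<close>)
    then have "filterlim (\<lambda>k. r k t) (at_left t) sequentially"
      using lt by (intro tendsto_imp_filterlim_at_left) auto
    from eventually_compose_filterlim[OF pre_left[OF t] this] show ?thesis .
  qed
  then have "eventually (\<lambda>k. y ^ N (r k t) x = y ^ pre t) sequentially"
    by eventually_elim simp
  then show "(\<lambda>k. case w of (t, x) \<Rightarrow> y ^ N (r k t) x)
      \<longlonglongrightarrow> (case w of (t, x) \<Rightarrow> y ^ counting_path.pre (\<lambda>s. N s x) t)"
    by (simp add: w tendsto_eventually)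
qed

text \<open>By monotonicity it suffices that \<open>N\<close> vanishes at all integer times, which
  are countably many almost sure events.\<close>

lemma no_jumps_if_no_intensity:
  assumes "lam = 0"
  shows "AE x in M. jump_times (\<lambda>t. N t x) = {}"
proof -
  have "AE x in M. N (real k) x = 0" for k
  proof -
    have [measurable]: "N 0 \<in> M \<rightarrow>\<^sub>M count_space UNIV" "N (real k) \<in> M \<rightarrow>\<^sub>M count_space UNIV"
      by (auto intro: measurable_N)
    have "AE x in M. x \<in> {x \<in> space M. N (real k) x - N 0 x = 0}"
      by (rule AE_prob_1) (use N_increment_law[of 0 "real k" 0] assms in simp)
    then show ?thesis by (rule AE_mp) (auto simp: N_start intro!: AE_I2)
  qed
  then have "AE x in M. \<forall>k. N (real k) x = 0" by (simp add: AE_all_countable)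
  then show ?thesis
  proof (rule AE_mp, intro AE_I2 impI)
    fix x assume x: "x \<in> space M" and 0: "\<forall>k. N (real k) x = 0"
    interpret counting_path "\<lambda>t. N t x" by (rule counting_path[OF x])
    have N0: "N t x = 0" if "0 \<le> t" for t
    proof -
      obtain k where "t \<le> real k" using real_arch_simple by blast
      from N_mono[OF x that this] 0 show ?thesis by simp
    qed
    show "jump_times (\<lambda>t. N t x) = {}"
    proof (rule ccontr)
      assume "jump_times (\<lambda>t. N t x) \<noteq> {}"
      then obtain t where "t \<in> jump_times (\<lambda>t. N t x)" by blast
      with n_eq_pre[of t] N0[of t] show False by (simp add: jump_times_def)
    qed
  qed
qed

end

section \<open>Expected time integrals\<close>

text \<open>In terms of the ratio \<open>r = h / g\<close> this is \<open>exp y \<ge> 1 + y\<close>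
  at \<open>y = - f * ln r\<close>, followed by \<open>ln r \<le> r - 1\<close>; equality in the
  latter forces \<open>r = 1\<close>.\<close>

lemma young_inequality:
  fixes f g h :: real
  assumes "0 < f" "0 < g" "0 < h"
  shows "(1 + f) * g \<le> g powr (1 + f) * h powr (- f) + f * h"
    and "g powr (1 + f) * h powr (- f) + f * h \<le> (1 + f) * g \<Longrightarrow> h = g"
proof -
  define r where "r = h / g"
  have r: "0 < r" "h = g * r" using assms by (auto simp: r_def)
  have eq: "g powr (1 + f) * h powr (- f) = g * r powr (- f)"
    using assms r by (simp add: powr_mult powr_add powr_minus field_simps)
  have exp: "1 - f * ln r \<le> r powr (- f)"
    using exp_ge_add_one_self[of "- f * ln r"] r by (simp add: powr_def)
  have ln: "f * ln r \<le> f * (r - 1)"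
    using ln_le_minus_one[OF r(1)] assms by (intro mult_left_mono) auto
  have "g * (1 + f - f * r) \<le> g * r powr (- f)"
    using exp ln assms by (intro mult_left_mono) (auto simp: algebra_simps)
  then show "(1 + f) * g \<le> g powr (1 + f) * h powr (- f) + f * h"
    unfolding eq using r by (simp add: algebra_simps)
  show "h = g" if "g powr (1 + f) * h powr (- f) + f * h \<le> (1 + f) * g"
  proof -
    have "g * r powr (- f) \<le> g * (1 + f - f * r)"
      using that unfolding eq using r by (simp add: algebra_simps)
    then have "r powr (- f) \<le> 1 + f - f * r" using assms by simp
    with exp have "f * (r - 1) \<le> f * ln r" by (simp add: algebra_simps)
    then have "r - 1 \<le> ln r" using assms by simp
    with ln_le_minus_one[OF r(1)] have "ln r = r - 1" by simp
    from ln_eq_minus_one[OF r(1) this] r show "h = g" by simp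
  qed
qed

text \<open>Values at negative times are arbitrary, hence the cut-off to the half-line.\<close>

definition jointly_measurable :: "'a measure \<Rightarrow> (real \<Rightarrow> 'a \<Rightarrow> real) \<Rightarrow> bool" where
  "jointly_measurable M f \<longleftrightarrow>
     (\<lambda>(t, x). indicator {0..} t * f t x) \<in> borel_measurable (borel \<Otimes>\<^sub>M M)"

lemma jointly_measurable_compose:
  assumes h: "h \<in> borel_measurable borel" and f: "jointly_measurable M f"
  shows "jointly_measurable M (\<lambda>t x. h (f t x))"
proof -
  note [measurable] = h f[unfolded jointly_measurable_def]
  \<comment> \<open>The outer indicator restores the value 0 at negative times, since
    \<open>h 0\<close> may differ from 0.\<close>
  have "(\<lambda>p. indicator {0..} (fst p) * h ((\<lambda>(t, x). indicator {0..} t * f t x) p)) \<in> borel_measurable (borel \<Otimes>\<^sub>M M)"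
    by measurable
  also have "(\<lambda>p. indicator {0..} (fst p) * h ((\<lambda>(t, x). indicator {0..} t * f t x) p))
     = (\<lambda>(t, x). indicator {0..} t * h (f t x))"
    by (auto simp: indicator_def)
  finally show ?thesis by (simp add: jointly_measurable_def)
qed

lemma jointly_measurable_mult:
  assumes "jointly_measurable M f" "jointly_measurable M g"
  shows "jointly_measurable M (\<lambda>t x. f t x * g t x)"
proof -
  note [measurable] = assms[unfolded jointly_measurable_def]
  have "(\<lambda>p. (\<lambda>(t, x). indicator {0..} t * f t x) p * (\<lambda>(t, x). indicator {0..} t * g t x) p) \<in> borel_measurable (borel \<Otimes>\<^sub>M M)"
    by measurable
  also have "(\<lambda>p. (\<lambda>(t, x). indicator {0..} t * f t x) p * (\<lambda>(t, x). indicator {0..} t * g t x) p)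
     = (\<lambda>(t, x). indicator {0..} t * (f t x * g t x))"
    by (auto simp: indicator_def)
  finally show ?thesis by (simp add: jointly_measurable_def)
qed

lemma jointly_measurable_add:
  assumes "jointly_measurable M f" "jointly_measurable M g"
  shows "jointly_measurable M (\<lambda>t x. f t x + g t x)"
proof -
  note [measurable] = assms[unfolded jointly_measurable_def]
  have "(\<lambda>p. (\<lambda>(t, x). indicator {0..} t * f t x) p + (\<lambda>(t, x). indicator {0..} t * g t x) p) \<in> borel_measurable (borel \<Otimes>\<^sub>M M)"
    by measurable
  also have "(\<lambda>p. (\<lambda>(t, x). indicator {0..} t * f t x) p + (\<lambda>(t, x). indicator {0..} t * g t x) p)
     = (\<lambda>(t, x). indicator {0..} t * (f t x + g t x))"
    by (auto simp: indicator_def)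
  finally show ?thesis by (simp add: jointly_measurable_def)
qed

lemma jointly_measurable_time:
  "g \<in> borel_measurable borel \<Longrightarrow> jointly_measurable M (\<lambda>t x. g t)"
  unfolding jointly_measurable_def case_prod_beta
  by (intro borel_measurable_times measurable_compose[OF measurable_fst, of g]
      measurable_compose[OF measurable_fst, of "indicator {0..}"]) measurable

lemma jointly_measurable_cmult:
  "jointly_measurable M f \<Longrightarrow> jointly_measurable M (\<lambda>t x. k * f t x)"
  by (rule jointly_measurable_compose[of "(*) k"]) measurable

lemma jointly_measurable_section:
  assumes "jointly_measurable M f" "x \<in> space M"
  shows "(\<lambda>t. indicator {0..} t * f t x) \<in> borel_measurable borel"
proof -
  have "(\<lambda>t. (\<lambda>(t, x). indicator {0..} t * f t x) (t, x)) \<in> borel_measurable borel"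
    by (rule measurable_compose[OF _ assms(1)[unfolded jointly_measurable_def]]) (use assms(2) in measurable)
  then show ?thesis by simp
qed

text \<open>The moving upper limit becomes the indicator of the measurable set
  \<open>0 \<le> s \<le> t\<close>, after which this is a parameter integral.\<close>

lemma jointly_measurable_primitive:
  assumes f: "jointly_measurable M f"
  shows "jointly_measurable M (\<lambda>t x. LINT s:{0..t}|lborel. f s x)"
proof -
  define g where "g = (\<lambda>(t, x). indicator {0..} t * f t x)"
  have [measurable]: "g \<in> borel_measurable (borel \<Otimes>\<^sub>M M)"
    using f by (simp add: g_def jointly_measurable_def)
  have "(\<lambda>p. LINT s|lborel. indicator {0..fst p} s * g (s, snd p)) \<in> borel_measurable (borel \<Otimes>\<^sub>M M)"
  proof (rule lborel.borel_measurable_lebesgue_integral)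
    have "(\<lambda>w. (if 0 \<le> snd w \<and> snd w \<le> fst (fst w) then 1 else 0) * g (snd w, snd (fst w)))
        \<in> borel_measurable ((borel \<Otimes>\<^sub>M M) \<Otimes>\<^sub>M lborel)"
      by measurable
    then show "(\<lambda>(p, s). indicator {0..fst p} s * g (s, snd p)) \<in> borel_measurable ((borel \<Otimes>\<^sub>M M) \<Otimes>\<^sub>M lborel)"
      by (simp add: case_prod_beta indicator_def)
  qed
  then have "(\<lambda>p. indicator {0..} (fst p) * (LINT s|lborel. indicator {0..fst p} s * g (s, snd p))) \<in> borel_measurable (borel \<Otimes>\<^sub>M M)"
    by measurable
  also have "(\<lambda>p. indicator {0..} (fst p) * (LINT s|lborel. indicator {0..fst p} s * g (s, snd p)))
     = (\<lambda>(t, x). indicator {0..} t * (LINT s:{0..t}|lborel. f s x))"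
  proof -
    have "(\<lambda>s. indicator {0..t} s * g (s, x)) = (\<lambda>s. indicator {0..t} s *\<^sub>R f s x)" for t x
      by (auto simp: g_def indicator_def)
    then show ?thesis by (intro ext) (simp only: set_lebesgue_integral_def case_prod_beta)
  qed
  finally show ?thesis by (simp add: jointly_measurable_def)
qed

section \<open>Fubini and linearity for expectations of time integrals\<close>

context prob_space
begin

text \<open>Passing through \<open>ennreal\<close> cuts negative values to 0, so sums split only for
  nonnegative integrands.\<close>

definition horizon_integral :: "(real \<Rightarrow> 'a \<Rightarrow> real) \<Rightarrow> ennreal" where
  "horizon_integral f = (\<integral>\<^sup>+x. (\<integral>\<^sup>+t\<in>{0..}. ennreal (f t x) \<partial>lborel) \<partial>M)"

text \<open>The set \<open>S\<close> provides for truncation at finite horizons, with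
  \<open>S = {..T}\<close>.\<close>

lemma horizon_integrand_measurable:
  assumes f: "jointly_measurable M f" and S: "S \<in> sets borel"
  shows "(\<lambda>(x, t). ennreal (f t x) * indicator ({0..} \<inter> S) t) \<in> borel_measurable (M \<Otimes>\<^sub>M lborel)"
proof -
  note S[measurable]
  have [measurable]: "(\<lambda>(x, t). indicator {0..} t * f t x) \<in> borel_measurable (M \<Otimes>\<^sub>M lborel)"
    using measurable_pair_swap[OF f[unfolded jointly_measurable_def]]
    by (simp add: cong: measurable_cong_sets)
  have "(\<lambda>p. ennreal ((\<lambda>(x, t). indicator {0..} t * f t x) p) * indicator S (snd p)) \<in> borel_measurable (M \<Otimes>\<^sub>M lborel)"
    by measurable
  also have "(\<lambda>p. ennreal ((\<lambda>(x, t). indicator {0..} t * f t x) p) * indicator S (snd p))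
      = (\<lambda>(x, t). ennreal (f t x) * indicator ({0..} \<inter> S) t)"
    by (auto simp: indicator_def)
  finally show ?thesis .
qed

lemma horizon_integrand_measurable_UNIV:
  "jointly_measurable M f \<Longrightarrow> (\<lambda>(x, t). ennreal (f t x) * indicator {0..} t) \<in> borel_measurable (M \<Otimes>\<^sub>M lborel)"
  using horizon_integrand_measurable[of f UNIV] by simp

lemma horizon_integrand_section:
  assumes "jointly_measurable M f" "x \<in> space M"
  shows "(\<lambda>t. ennreal (f t x) * indicator {0..} t) \<in> borel_measurable lborel"
  using measurable_compose[OF measurable_Pair1'[OF assms(2)] horizon_integrand_measurable_UNIV[OF assms(1)]] by simp

lemma horizon_integral_inner_measurable:
  assumes "jointly_measurable M f"
  shows "(\<lambda>x. \<integral>\<^sup>+t\<in>{0..}. ennreal (f t x) \<partial>lborel) \<in> borel_measurable M"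
  using horizon_integrand_measurable_UNIV[OF assms] by (intro lborel.borel_measurable_nn_integral) simp

lemma nn_integral_swap:
  assumes "jointly_measurable M f" "S \<in> sets borel"
  shows "(\<integral>\<^sup>+x. (\<integral>\<^sup>+t\<in>{0..} \<inter> S. ennreal (f t x) \<partial>lborel) \<partial>M)
       = (\<integral>\<^sup>+t\<in>{0..} \<inter> S. (\<integral>\<^sup>+x. ennreal (f t x) \<partial>M) \<partial>lborel)"
proof -
  interpret pair_sigma_finite M lborel ..
  have "(\<integral>\<^sup>+x. (\<integral>\<^sup>+t\<in>{0..} \<inter> S. ennreal (f t x) \<partial>lborel) \<partial>M)
      = (\<integral>\<^sup>+t. (\<integral>\<^sup>+x. ennreal (f t x) * indicator ({0..} \<inter> S) t \<partial>M) \<partial>lborel)"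
    by (rule Fubini'[symmetric, OF horizon_integrand_measurable[OF assms]])
  also have "\<dots> = (\<integral>\<^sup>+t\<in>{0..} \<inter> S. (\<integral>\<^sup>+x. ennreal (f t x) \<partial>M) \<partial>lborel)"
    by (intro nn_integral_cong) (auto simp: indicator_def)
  finally show ?thesis .
qed

lemma horizon_integral_add:
  assumes f: "jointly_measurable M f" and g: "jointly_measurable M g"
    and nn: "\<And>t x. 0 \<le> t \<Longrightarrow> x \<in> space M \<Longrightarrow> 0 \<le> f t x" "\<And>t x. 0 \<le> t \<Longrightarrow> x \<in> space M \<Longrightarrow> 0 \<le> g t x"
  shows "horizon_integral (\<lambda>t x. f t x + g t x) = horizon_integral f + horizon_integral g"
proof -
  have "horizon_integral (\<lambda>t x. f t x + g t x) = (\<integral>\<^sup>+x. (\<integral>\<^sup>+t\<in>{0..}. ennreal (f t x) \<partial>lborel) + (\<integral>\<^sup>+t\<in>{0..}. ennreal (g t x) \<partial>lborel) \<partial>M)"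
    unfolding horizon_integral_def
  proof (rule nn_integral_cong)
    fix x assume x: "x \<in> space M"
    have "(\<integral>\<^sup>+t\<in>{0..}. ennreal (f t x + g t x) \<partial>lborel)
        = (\<integral>\<^sup>+t. ennreal (f t x) * indicator {0..} t + ennreal (g t x) * indicator {0..} t \<partial>lborel)"
      using nn x by (intro nn_integral_cong) (auto simp: indicator_def)
    then show "(\<integral>\<^sup>+t\<in>{0..}. ennreal (f t x + g t x) \<partial>lborel)
        = (\<integral>\<^sup>+t\<in>{0..}. ennreal (f t x) \<partial>lborel) + (\<integral>\<^sup>+t\<in>{0..}. ennreal (g t x) \<partial>lborel)"
      using horizon_integrand_section[OF f x] horizon_integrand_section[OF g x] by (simp add: nn_integral_add)
  qed
  then show ?thesis using horizon_integral_inner_measurable[OF f] horizon_integral_inner_measurable[OF g] by (simp add: horizon_integral_def nn_integral_add)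
qed

lemma horizon_integral_cmult:
  assumes f: "jointly_measurable M f" and k: "0 \<le> k"
  shows "horizon_integral (\<lambda>t x. k * f t x) = ennreal k * horizon_integral f"
proof -
  have "horizon_integral (\<lambda>t x. k * f t x) = (\<integral>\<^sup>+x. ennreal k * (\<integral>\<^sup>+t\<in>{0..}. ennreal (f t x) \<partial>lborel) \<partial>M)"
    unfolding horizon_integral_def using horizon_integrand_section[OF f] k
    by (intro nn_integral_cong) (simp add: ennreal_mult' mult.assoc nn_integral_cmult)
  then show ?thesis using horizon_integral_inner_measurable[OF f] by (simp add: horizon_integral_def nn_integral_cmult)
qed

lemma horizon_integral_cong_AE:
  assumes "AE x in M. AE t in lborel. 0 \<le> t \<longrightarrow> f t x = g t x"
  shows "horizon_integral f = horizon_integral g"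
  unfolding horizon_integral_def
proof (rule nn_integral_cong_AE, use assms in eventually_elim)
  case (elim x)
  then show ?case
    by (intro nn_integral_cong_AE) (auto elim!: eventually_mono simp: indicator_def)
qed

text \<open>Only an upper bound on \<open>f\<close> results, because its negative part does not
  contribute to the integral.\<close>

lemma horizon_integral_eq_0:
  assumes f: "jointly_measurable M f" and 0: "horizon_integral f = 0"
  shows "AE x in M. AE t in lborel. 0 \<le> t \<longrightarrow> f t x \<le> 0"
proof -
  have "AE x in M. (\<integral>\<^sup>+t\<in>{0..}. ennreal (f t x) \<partial>lborel) = 0"
    using 0 unfolding horizon_integral_def by (simp add: nn_integral_0_iff_AE[OF horizon_integral_inner_measurable[OF f]])
  with AE_space show ?thesis
  proof eventually_elim
    case (elim x)
    note x = elim(1)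
    from elim(2)
    have "AE t in lborel. ennreal (f t x) * indicator {0..} t = 0"
      by (simp add: nn_integral_0_iff_AE[OF horizon_integrand_section[OF f x]])
    then show ?case
      by eventually_elim (auto simp: indicator_def ennreal_eq_0_iff split: if_splits)
  qed
qed

end

context poisson_filtered_space
begin

lemma jointly_measurable_power_N: "jointly_measurable M (\<lambda>t x. y ^ N t x)"
  using power_N_joint_measurable by (simp add: jointly_measurable_def)

lemma jointly_measurable_power_martingale: "jointly_measurable M (power_martingale z)"
  unfolding power_martingale_def
  by (intro jointly_measurable_mult jointly_measurable_power_N jointly_measurable_time) measurable

text \<open>For adapted \<open>h\<close> the martingale property replaces \<open>power_martingale z t\<close> by its value at any
  later time \<open>T\<close>, which comes out of the time integral; then the pathwise bound on \<open>\<integral> h\<close> applies.\<close>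

lemma horizon_integral_martingale_adapted_le:
  assumes h: "jointly_measurable M h" and z: "0 \<le> z" and k: "0 \<le> k"
    and adapted: "\<And>t. 0 \<le> t \<Longrightarrow> \<exists>g. g \<in> borel_measurable (F t) \<and> (AE x in M. h t x = g x)"
    and nonneg: "\<And>t x. 0 \<le> t \<Longrightarrow> x \<in> space M \<Longrightarrow> 0 \<le> h t x"
    and bound: "\<And>T. 0 \<le> T \<Longrightarrow> AE x in M. (\<integral>\<^sup>+t\<in>{0..T}. ennreal (h t x) \<partial>lborel) \<le> ennreal k"
  shows "horizon_integral (\<lambda>t x. power_martingale z t x * h t x) \<le> ennreal k"
proof -
  have Zh: "jointly_measurable M (\<lambda>t x. power_martingale z t x * h t x)"
    by (intro jointly_measurable_mult jointly_measurable_power_martingale h)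
  have fin: "(\<integral>\<^sup>+x. (\<integral>\<^sup>+t\<in>{0..T}. ennreal (power_martingale z t x * h t x) \<partial>lborel) \<partial>M) \<le> ennreal k" if T: "0 \<le> T" for T
  proof -
    have S: "{0..} \<inter> {..T} = {0..T}" by auto
    have ZT: "power_martingale z T \<in> borel_measurable M"
      using measurable_from_subalg[OF subalgebra_F[OF T] power_martingale_measurable[OF T]] .
    have ZTj: "jointly_measurable M (\<lambda>t x. power_martingale z T x * h t x)"
    proof (intro jointly_measurable_mult h)
      show "jointly_measurable M (\<lambda>t. power_martingale z T)"
        unfolding jointly_measurable_def using ZT by measurable
    qed
    have "(\<integral>\<^sup>+x. (\<integral>\<^sup>+t\<in>{0..T}. ennreal (power_martingale z t x * h t x) \<partial>lborel) \<partial>M)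
        = (\<integral>\<^sup>+t\<in>{0..T}. (\<integral>\<^sup>+x. ennreal (power_martingale z t x * h t x) \<partial>M) \<partial>lborel)"
      using nn_integral_swap[OF Zh, of "{..T}"] by (simp add: S)
    also have "\<dots> = (\<integral>\<^sup>+t\<in>{0..T}. (\<integral>\<^sup>+x. ennreal (power_martingale z T x * h t x) \<partial>M) \<partial>lborel)"
    proof (intro set_nn_integral_cong)
      fix t assume "t \<in> space lborel \<inter> {0..T}"
      then have t: "0 \<le> t" "t \<le> T" by auto
      \<comment> \<open>Null sets need not belong to \<open>F t\<close>, so \<open>h t\<close>
        itself may fail to be \<open>F t\<close>-measurable; the martingale step is applied to its
        version \<open>g\<close>.\<close>
      obtain g where g: "g \<in> borel_measurable (F t)" "AE x in M. h t x = g x"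
        using adapted[OF t(1)] by blast
      have *: "(\<integral>\<^sup>+x. ennreal (power_martingale z s x * h t x) \<partial>M) = (\<integral>\<^sup>+x. ennreal (g x) * ennreal (power_martingale z s x) \<partial>M)" for s
      proof (rule nn_integral_cong_AE)
        show "AE x in M. ennreal (power_martingale z s x * h t x) = ennreal (g x) * ennreal (power_martingale z s x)"
          using g(2) by eventually_elim (simp add: ennreal_mult'' power_martingale_nonneg[OF z] mult.commute)
      qed
      have "(\<lambda>x. ennreal (g x)) \<in> borel_measurable (F t)" using g(1) by measurable
      from power_martingale_step[OF this t z] show "(\<integral>\<^sup>+x. ennreal (power_martingale z t x * h t x) \<partial>M) = (\<integral>\<^sup>+x. ennreal (power_martingale z T x * h t x) \<partial>M)"
        unfolding * by simp
    qed simp_all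
    also have "\<dots> = (\<integral>\<^sup>+x. (\<integral>\<^sup>+t\<in>{0..T}. ennreal (power_martingale z T x * h t x) \<partial>lborel) \<partial>M)"
      using nn_integral_swap[OF ZTj, of "{..T}"] by (simp add: S)
    also have "\<dots> \<le> (\<integral>\<^sup>+x. ennreal (power_martingale z T x) * ennreal k \<partial>M)"
    proof (rule nn_integral_mono_AE)
      show "AE x in M. (\<integral>\<^sup>+t\<in>{0..T}. ennreal (power_martingale z T x * h t x) \<partial>lborel) \<le> ennreal (power_martingale z T x) * ennreal k"
        using bound[OF T] AE_space
      proof eventually_elim
        case (elim x)
        have m: "(\<lambda>t. ennreal (h t x) * indicator {0..T} t) \<in> borel_measurable lborel"
          using measurable_compose[OF measurable_Pair1'[OF elim(2)] horizon_integrand_measurable[OF h, of "{..T}"]]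
          by (simp add: S)
        have "(\<integral>\<^sup>+t\<in>{0..T}. ennreal (power_martingale z T x * h t x) \<partial>lborel)
            = ennreal (power_martingale z T x) * (\<integral>\<^sup>+t\<in>{0..T}. ennreal (h t x) \<partial>lborel)"
          using m by (simp add: ennreal_mult' power_martingale_nonneg[OF z] mult.assoc nn_integral_cmult)
        also have "\<dots> \<le> ennreal (power_martingale z T x) * ennreal k"
          by (intro mult_left_mono elim) simp
        finally show ?case .
      qed
    qed
    also have "\<dots> = ennreal k"
      using ZT power_martingale_expectation[OF T z] by (simp add: nn_integral_multc)
    finally show ?thesis .
  qed
  \<comment> \<open>The martingale exchange works on finite horizons, with a bound independent of
    \<open>T\<close>; monotone convergence along integer horizons extends it.\<close>
  define f where "f = (\<lambda>n x. \<integral>\<^sup>+t\<in>{0..real n}. ennreal (power_martingale z t x * h t x) \<partial>lborel)"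
  have S: "{0..} \<inter> {..T} = {0..T}" for T :: real by auto
  have fm: "f n \<in> borel_measurable M" for n
    unfolding f_def using horizon_integrand_measurable[OF Zh, of "{..real n}"]
    by (intro lborel.borel_measurable_nn_integral) (simp add: S)
  have "horizon_integral (\<lambda>t x. power_martingale z t x * h t x) = (\<integral>\<^sup>+x. (SUP n. f n x) \<partial>M)"
    unfolding horizon_integral_def
  proof (rule nn_integral_cong)
    fix x assume x: "x \<in> space M"
    have "(SUP n. f n x) = (\<integral>\<^sup>+t. (SUP n. ennreal (power_martingale z t x * h t x) * indicator {0..real n} t) \<partial>lborel)"
      unfolding f_def
    proof (rule nn_integral_monotone_convergence_SUP[symmetric])
      show "incseq (\<lambda>n t. ennreal (power_martingale z t x * h t x) * indicator {0..real n} t)"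
        by (auto simp: incseq_def le_fun_def indicator_def)
      show "(\<lambda>t. ennreal (power_martingale z t x * h t x) * indicator {0..real n} t) \<in> borel_measurable lborel" for n
        using measurable_compose[OF measurable_Pair1'[OF x] horizon_integrand_measurable[OF Zh, of "{..real n}"]]
        by (simp add: S)
    qed
    also have "\<dots> = (\<integral>\<^sup>+t\<in>{0..}. ennreal (power_martingale z t x * h t x) \<partial>lborel)"
    proof (rule nn_integral_cong)
      fix t :: real
      show "(SUP n. ennreal (power_martingale z t x * h t x) * indicator {0..real n} t) = ennreal (power_martingale z t x * h t x) * indicator {0..} t"
      proof (rule antisym)
        show "(SUP n. ennreal (power_martingale z t x * h t x) * indicator {0..real n} t) \<le> ennreal (power_martingale z t x * h t x) * indicator {0..} t"
          by (rule SUP_least) (auto simp: indicator_def)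
        obtain n where "t \<le> real n" using real_arch_simple by blast
        then show "ennreal (power_martingale z t x * h t x) * indicator {0..} t \<le> (SUP n. ennreal (power_martingale z t x * h t x) * indicator {0..real n} t)"
          by (intro SUP_upper2[of n]) (auto simp: indicator_def)
      qed
    qed
    finally show "(\<integral>\<^sup>+t\<in>{0..}. ennreal (power_martingale z t x * h t x) \<partial>lborel) = (SUP n. f n x)" by simp
  qed
  also have "\<dots> = (SUP n. \<integral>\<^sup>+x. f n x \<partial>M)"
  proof (rule nn_integral_monotone_convergence_SUP[OF _ fm])
    show "incseq f"
      unfolding f_def incseq_def le_fun_def by (auto intro!: nn_integral_mono simp: indicator_def)
  qed
  also have "\<dots> \<le> ennreal k" unfolding f_def by (rule SUP_least) (simp add: fin)
  finally show ?thesis .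
qed

text \<open>After exchanging the integrals only the expectation of the martingale remains at each
  time, and it equals 1.\<close>

lemma horizon_integral_martingale_time:
  assumes g: "g \<in> borel_measurable borel" and nonneg: "\<And>t. 0 \<le> t \<Longrightarrow> 0 \<le> g t" and z: "0 \<le> z"
  shows "horizon_integral (\<lambda>t x. power_martingale z t x * g t) = (\<integral>\<^sup>+t\<in>{0..}. ennreal (g t) \<partial>lborel)"
proof -
  have "horizon_integral (\<lambda>t x. power_martingale z t x * g t) = (\<integral>\<^sup>+t\<in>{0..}. (\<integral>\<^sup>+x. ennreal (power_martingale z t x * g t) \<partial>M) \<partial>lborel)"
    using nn_integral_swap[of "\<lambda>t x. power_martingale z t x * g t" UNIV]
    by (simp add: horizon_integral_def jointly_measurable_mult[OF jointly_measurable_power_martingale jointly_measurable_time[OF g]])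
  also have "\<dots> = (\<integral>\<^sup>+t\<in>{0..}. ennreal (g t) \<partial>lborel)"
  proof (intro set_nn_integral_cong)
    fix t :: real assume "t \<in> space lborel \<inter> {0..}"
    then have t: "0 \<le> t" by simp
    have "power_martingale z t \<in> borel_measurable M"
      using measurable_from_subalg[OF subalgebra_F[OF t] power_martingale_measurable[OF t]] .
    then show "(\<integral>\<^sup>+x. ennreal (power_martingale z t x * g t) \<partial>M) = ennreal (g t)"
      using power_martingale_expectation[OF t z] by (simp add: ennreal_mult power_martingale_nonneg[OF z] nonneg[OF t] nn_integral_multc)
  qed simp_all
  finally show ?thesis .
qed

end

section \<open>The control problem\<close>

text \<open>The assumption \<open>omega\<close> makes \<open>p\<close> and \<open>q\<close>
  positive. With \<open>kappa_star_pos\<close> the linear feedback is a positive control and the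
  associated \<open>H_opt\<close> decays.\<close>

locale addiction_control = poisson_filtered_space M F N lam
  for M :: "'a measure" and F :: "real \<Rightarrow> 'a measure" and N :: "real \<Rightarrow> 'a \<Rightarrow> nat" and lam :: real +
  fixes \<rho> \<delta> \<phi> \<theta>\<^sub>1 \<theta>\<^sub>2 \<omega> a :: real
  assumes phi: "0 < \<phi>" and theta2: "- 1 < \<theta>\<^sub>2"
    and lam_theta1: "lam * \<theta>\<^sub>1 = 0" and omega: "\<phi> < \<omega>"
    and kappa_star_pos: "0 < kappa_star \<rho> \<delta> \<phi> lam \<theta>\<^sub>2 \<omega>"
    and a_pos: "0 < a"
begin

definition \<kappa> :: real where "\<kappa> = kappa_star \<rho> \<delta> \<phi> lam \<theta>\<^sub>2 \<omega>"
definition p :: real where "p = \<omega> - \<phi>"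
definition q :: real where "q = p / \<phi>"
text \<open>The factor by which one jump multiplies \<open>D powr p\<close>.\<close>

definition z :: real where "z = (1 + \<theta>\<^sub>2) powr p"
definition D :: "real \<Rightarrow> 'a \<Rightarrow> real" where "D t x = exp (- \<delta> * t) * (1 + \<theta>\<^sub>2) ^ N t x"
definition B :: "(real \<Rightarrow> 'a \<Rightarrow> real) \<Rightarrow> real \<Rightarrow> 'a \<Rightarrow> real" where
  "B c t x = a + (LINT s:{0..t}|lborel. c s x / D s x)"

text \<open>The rescaled control: \<open>H c\<close> is minus the time derivative of \<open>(B c) powr (- q) / q\<close>, so that its
  total integral cannot exceed \<open>y0\<close>, and the cost is a convex functional of it.\<close>

definition H :: "(real \<Rightarrow> 'a \<Rightarrow> real) \<Rightarrow> real \<Rightarrow> 'a \<Rightarrow> real" where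
  "H c t x = c t x / D t x * B c t x powr (- (q + 1))"
text \<open>Under \<open>c = \<kappa> * A\<close> the rescaled state is
  \<open>a * exp (\<kappa> * t)\<close>, and \<open>H\<close> becomes \<open>\<kappa>\<close> times
  its power \<open>- q\<close>.\<close>

definition H_opt :: "real \<Rightarrow> real" where "H_opt t = \<kappa> * a powr (- q) * exp (- (\<kappa> * q * t))"
definition y0 :: real where "y0 = a powr (- q) / q"
text \<open>A Lagrange multiplier up to the factor \<open>\<phi>\<close>: the derivative of the
  weighted cost density in \<open>H\<close> at \<open>H_opt\<close> is \<open>- \<phi> * C\<close>
  times the martingale.\<close>

definition C :: real where "C = (\<kappa> * a powr (- q)) powr (- (1 + \<phi>))"
definition cost :: "(real \<Rightarrow> 'a \<Rightarrow> real) \<Rightarrow> (real \<Rightarrow> 'a \<Rightarrow> real) \<Rightarrow> ennreal" where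
  "cost c A = horizon_integral (\<lambda>t x. A t x powr \<omega> * c t x powr (- \<phi>) * exp (- \<rho> * t))"

lemma objective_eq: "objective M \<rho> \<phi> \<omega> c A = - enn2ereal (cost c A)"
  by (simp add: objective_def cost_def horizon_integral_def)

lemma kappa: "0 < \<kappa>" and p: "0 < p" and q: "0 < q" and z: "0 < z" and y0: "0 < y0" and C: "0 < C"
  and H_opt: "0 < H_opt t" and D: "0 < D t x"
  using kappa_star_pos omega phi theta2 a_pos
  by (auto simp: \<kappa>_def p_def q_def z_def y0_def C_def H_opt_def D_def)

text \<open>This relation determines \<open>\<kappa>\<close>: the deterministic part of the weight
  must decay like \<open>H_opt powr (1 + \<phi>)\<close>, so that the slope of the tangent retains
  no time dependence besides the martingale.\<close>

lemma kappa_eq: "\<kappa> * q * (1 + \<phi>) = \<rho> - lam * (z - 1) + \<delta> * p"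
proof -
  define R where "R = \<rho> - lam * (z - 1)"
  have "\<kappa> = \<phi> / (\<phi> + 1) * (R / p + \<delta>)"
    by (simp add: \<kappa>_def kappa_star_def R_def z_def p_def)
  then have "\<kappa> * q * (1 + \<phi>) = (\<phi> / (\<phi> + 1) * (1 + \<phi>) / \<phi>) * ((R / p + \<delta>) * p)"
    by (simp add: q_def)
  also have "\<phi> / (\<phi> + 1) * (1 + \<phi>) / \<phi> = 1" using phi by (simp add: add.commute[of 1])
  also have "(R / p + \<delta>) * p = R + \<delta> * p" using p by (simp add: field_simps)
  finally show ?thesis by (simp add: R_def)
qed

lemma q_phi: "(q + 1) * \<phi> = \<omega>"
  using phi by (simp add: q_def p_def field_simps)

lemma D_powr: "D t x powr p * exp (- \<rho> * t) = power_martingale z t x * exp (- (\<kappa> * q * (1 + \<phi>) * t))"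
proof -
  have "((1 + \<theta>\<^sub>2) ^ N t x) powr p = z ^ N t x"
    using theta2 by (simp add: z_def powr_powr mult.commute flip: powr_realpow)
  then have "D t x powr p = exp (- \<delta> * p * t) * z ^ N t x"
    using theta2 by (simp add: D_def powr_mult exp_powr_real mult_ac)
  moreover have "exp (- \<delta> * p * t) * exp (- \<rho> * t)
      = exp (- (lam * (z - 1) * t)) * exp (- (\<kappa> * q * (1 + \<phi>) * t))"
    unfolding kappa_eq by (simp add: algebra_simps flip: exp_add)
  ultimately show ?thesis by (simp add: power_martingale_def mult_ac)
qed

lemma C_H_opt: "C * H_opt t powr (1 + \<phi>) = exp (- (\<kappa> * q * (1 + \<phi>) * t))"
proof -
  define k where "k = \<kappa> * a powr (- q)"
  have k: "0 < k" using kappa a_pos by (simp add: k_def)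
  have "C * H_opt t powr (1 + \<phi>) = (k powr (- (1 + \<phi>)) * k powr (1 + \<phi>)) * exp (- (\<kappa> * q * t) * (1 + \<phi>))"
    using k by (simp add: C_def H_opt_def powr_mult exp_powr_real mult.assoc flip: k_def)
  also have "k powr (- (1 + \<phi>)) * k powr (1 + \<phi>) = 1"
    using k by (simp flip: powr_add)
  finally show ?thesis by (simp add: mult_ac)
qed

text \<open>The variables \<open>b\<close> and \<open>h\<close> are left free so that the identity
  serves both \<open>B c\<close>, \<open>H c\<close> for a general control and the explicit values
  along the candidate.\<close>

lemma cost_density:
  assumes b: "0 < b" and h: "0 < h"
  shows "(D t x * b) powr \<omega> * (h * D t x * b powr (q + 1)) powr (- \<phi>) * exp (- \<rho> * t)
    = C * (power_martingale z t x * (H_opt t powr (1 + \<phi>) * h powr (- \<phi>)))"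
proof -
  have "(b powr (q + 1)) powr (- \<phi>) = b powr (- \<omega>)"
    using q_phi by (simp add: powr_powr)
  then have "(D t x * b) powr \<omega> * (h * D t x * b powr (q + 1)) powr (- \<phi>)
      = (D t x powr \<omega> * D t x powr (- \<phi>)) * (b powr \<omega> * b powr (- \<omega>)) * h powr (- \<phi>)"
    using b h D[of t x] by (simp add: powr_mult mult_ac)
  also have "\<dots> = D t x powr p * h powr (- \<phi>)"
    using b D[of t x] by (simp add: p_def flip: powr_add)
  finally have "(D t x * b) powr \<omega> * (h * D t x * b powr (q + 1)) powr (- \<phi>) * exp (- \<rho> * t)
     = (D t x powr p * exp (- \<rho> * t)) * h powr (- \<phi>)" by (simp add: mult_ac)
  also have "\<dots> = C * (power_martingale z t x * (H_opt t powr (1 + \<phi>) * h powr (- \<phi>)))"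
    unfolding D_powr C_H_opt[symmetric] by (simp add: mult_ac)
  finally show ?thesis .
qed

text \<open>\<open>K_star\<close> is \<open>\<kappa> powr (- (1 + \<phi>))\<close>, and the powers
  of \<open>a\<close> combine through \<open>q * \<phi> = p\<close>.\<close>

lemma C_y0: "C * y0 = K_star \<rho> \<delta> \<phi> lam \<theta>\<^sub>2 \<omega> * \<phi> / (\<omega> - \<phi>) * a powr (\<omega> - \<phi>)"
proof -
  define X where "X = (\<rho> - lam * ((1 + \<theta>\<^sub>2) powr (\<omega> - \<phi>) - 1)) / (\<omega> - \<phi>) + \<delta>"
  have k: "\<kappa> = \<phi> / (\<phi> + 1) * X" by (simp add: \<kappa>_def kappa_star_def X_def)
  then have "(\<phi> + 1) / (\<phi> * X) = inverse \<kappa>" by (simp add: field_simps)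
  then have "K_star \<rho> \<delta> \<phi> lam \<theta>\<^sub>2 \<omega> = inverse \<kappa> powr (1 + \<phi>)"
    by (simp add: K_star_def X_def)
  also have "\<dots> = \<kappa> powr (- (1 + \<phi>))" using kappa by (simp only: inverse_powr powr_minus)
  finally have K: "K_star \<rho> \<delta> \<phi> lam \<theta>\<^sub>2 \<omega> = \<kappa> powr (- (1 + \<phi>))" .
  have "(a powr (- q)) powr (- (1 + \<phi>)) * a powr (- q) = a powr (q * \<phi>)"
    using a_pos by (simp add: powr_powr algebra_simps flip: powr_add)
  also have "q * \<phi> = p" using phi by (simp add: q_def)
  finally have "(a powr (- q)) powr (- (1 + \<phi>)) * a powr (- q) = a powr p" .
  then have "C * y0 = \<kappa> powr (- (1 + \<phi>)) * a powr p / q"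
    using kappa a_pos by (simp add: C_def y0_def powr_mult mult.assoc del: minus_add_distrib)
  then show ?thesis unfolding K by (simp add: q_def p_def)
qed

section \<open>The rescaled control: measurability, sign and integrability\<close>

lemma jointly_measurable_c: "admissible M F c \<Longrightarrow> jointly_measurable M c"
  using predictable_joint_measurable[of c] by (simp add: admissible_def jointly_measurable_def)

lemma jointly_measurable_D: "jointly_measurable M D"
  unfolding D_def
  by (intro jointly_measurable_mult jointly_measurable_power_N jointly_measurable_time) measurable

lemma jointly_measurable_cD: "admissible M F c \<Longrightarrow> jointly_measurable M (\<lambda>t x. c t x / D t x)"
  unfolding divide_inverse
  by (intro jointly_measurable_mult jointly_measurable_c jointly_measurable_compose[OF _ jointly_measurable_D])
    measurable

lemma jointly_measurable_H: "admissible M F c \<Longrightarrow> jointly_measurable M (H c)"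
  unfolding H_def B_def
  by (intro jointly_measurable_mult jointly_measurable_cD jointly_measurable_add jointly_measurable_time
      jointly_measurable_primitive jointly_measurable_compose[where h = "\<lambda>y. y powr (- (q + 1))"]) measurable

lemma c_pos: "admissible M F c \<Longrightarrow> 0 \<le> t \<Longrightarrow> x \<in> space M \<Longrightarrow> 0 < c t x"
  by (simp add: admissible_def)

lemma B_pos: "admissible M F c \<Longrightarrow> x \<in> space M \<Longrightarrow> 0 < B c t x"
proof -
  assume c: "admissible M F c" and x: "x \<in> space M"
  \<comment> \<open>Valid on every path, since the Bochner integral of a non-integrable function is
    0.\<close>
  have "0 \<le> (LINT s:{0..t}|lborel. c s x / D s x)"
    unfolding set_lebesgue_integral_def
  proof (rule Bochner_Integration.integral_nonneg)
    show "0 \<le> indicator {0..t} s *\<^sub>R (c s x / D s x)" for s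
    proof (cases "s \<in> {0..t}")
      case True
      then have "0 < c s x / D s x" using c_pos[OF c _ x, of s] D[of s x] by (intro divide_pos_pos) auto
      then show ?thesis using True by simp
    qed simp
  qed
  with a_pos show ?thesis by (simp add: B_def)
qed

lemma H_pos: "admissible M F c \<Longrightarrow> 0 \<le> t \<Longrightarrow> x \<in> space M \<Longrightarrow> 0 < H c t x"
  using c_pos[of c t x] B_pos[of c x t] D[of t x] by (simp add: H_def)

lemma control_eq:
  assumes "admissible M F c" "x \<in> space M"
  shows "c t x = H c t x * D t x * B c t x powr (q + 1)"
proof -
  have "B c t x powr (- (q + 1)) * B c t x powr (q + 1) = 1"
    using B_pos[OF assms, of t] by (simp flip: powr_add)
  then show ?thesis using D[of t x] by (simp add: H_def)
qed

text \<open>An expectation that is finite makes the path integral of \<open>c\<^sup>2\<close> finite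
  almost surely, simultaneously for all integer horizons, and
  \<open>\<bar>c\<bar> \<le> 1 + c\<^sup>2\<close> on bounded intervals does the rest.\<close>

lemma control_integrable:
  assumes c: "admissible M F c"
  shows "AE x in M. \<forall>T. set_integrable lborel {0..T} (\<lambda>s. c s x)"
proof -
  have c2: "jointly_measurable M (\<lambda>t x. (c t x)\<^sup>2)"
    using jointly_measurable_compose[OF _ jointly_measurable_c[OF c], of "\<lambda>y. y\<^sup>2"] by simp
  have S: "{0..} \<inter> {..T} = {0..T}" for T :: real by auto
  have "AE x in M. (\<integral>\<^sup>+t\<in>{0..real n}. ennreal ((c t x)\<^sup>2) \<partial>lborel) \<noteq> \<infinity>" for n
  proof (rule nn_integral_PInf_AE)
    show "(\<lambda>x. \<integral>\<^sup>+t\<in>{0..real n}. ennreal ((c t x)\<^sup>2) \<partial>lborel) \<in> borel_measurable M"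
      using horizon_integrand_measurable[OF c2, of "{..real n}"]
      by (intro lborel.borel_measurable_nn_integral) (simp add: S)
    show "(\<integral>\<^sup>+x. (\<integral>\<^sup>+t\<in>{0..real n}. ennreal ((c t x)\<^sup>2) \<partial>lborel) \<partial>M) \<noteq> \<infinity>"
    proof -
      have "\<forall>T\<ge>0. (\<integral>\<^sup>+x. (\<integral>\<^sup>+t\<in>{0..T}. ennreal ((c t x)\<^sup>2) \<partial>lborel) \<partial>M) < \<infinity>"
        using c unfolding admissible_def by blast
      from this[rule_format, of "real n"] show ?thesis by simp
    qed
  qed
  then have "AE x in M. \<forall>n. (\<integral>\<^sup>+t\<in>{0..real n}. ennreal ((c t x)\<^sup>2) \<partial>lborel) \<noteq> \<infinity>"
    by (simp add: AE_all_countable)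
  with AE_space show ?thesis
  proof eventually_elim
    case (elim x)
    show "\<forall>T. set_integrable lborel {0..T} (\<lambda>s. c s x)"
    proof
      fix T :: real
      obtain n where n: "T \<le> real n" using real_arch_simple by blast
      have m2: "(\<lambda>t. ennreal ((c t x)\<^sup>2) * indicator {0..real n} t) \<in> borel_measurable lborel"
        using measurable_compose[OF measurable_Pair1'[OF elim(1)] horizon_integrand_measurable[OF c2, of "{..real n}"]]
        by (simp add: S)
      have "integrable lborel (\<lambda>s. indicator {0..real n} s *\<^sub>R c s x)"
      proof (rule integrableI_bounded)
        have "(\<lambda>s. indicator {0..real n} s * (indicator {0..} s * c s x)) \<in> borel_measurable borel"
          using jointly_measurable_section[OF jointly_measurable_c[OF c] elim(1)] by measurable
        also have "(\<lambda>s. indicator {0..real n} s * (indicator {0..} s * c s x)) = (\<lambda>s. indicator {0..real n} s *\<^sub>R c s x)"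
          by (auto simp: indicator_def)
        finally show "(\<lambda>s. indicator {0..real n} s *\<^sub>R c s x) \<in> borel_measurable lborel" by simp
        have "(\<integral>\<^sup>+s. ennreal (norm (indicator {0..real n} s *\<^sub>R c s x)) \<partial>lborel)
            \<le> (\<integral>\<^sup>+s. indicator {0..real n} s + ennreal ((c s x)\<^sup>2) * indicator {0..real n} s \<partial>lborel)"
        proof (rule nn_integral_mono)
          fix s :: real
          have "\<bar>c s x\<bar> \<le> 1 + (c s x)\<^sup>2"
            using zero_le_power2[of "\<bar>c s x\<bar> - 1"] by (simp add: power2_eq_square algebra_simps)
          then have "ennreal \<bar>c s x\<bar> \<le> ennreal (1 + (c s x)\<^sup>2)" by (rule ennreal_leI)
          then show "ennreal (norm (indicator {0..real n} s *\<^sub>R c s x))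
            \<le> indicator {0..real n} s + ennreal ((c s x)\<^sup>2) * indicator {0..real n} s"
            by (auto simp: indicator_def)
        qed
        also have "\<dots> = ennreal (real n) + (\<integral>\<^sup>+t\<in>{0..real n}. ennreal ((c t x)\<^sup>2) \<partial>lborel)"
          using m2 by (subst nn_integral_add) auto
        also have "\<dots> < \<infinity>" using elim(2) by (simp add: top.not_eq_extremum)
        finally show "(\<integral>\<^sup>+s. ennreal (norm (indicator {0..real n} s *\<^sub>R c s x)) \<partial>lborel) < \<infinity>" .
      qed
      then show "set_integrable lborel {0..T} (\<lambda>s. c s x)"
        by (intro set_integrable_subset[where A = "{0..real n}" and B = "{0..T}", unfolded set_integrable_def[of _ "{0..real n}"]])
          (use n in auto)
    qed
  qed
qed

section \<open>Solving the state equation and the budget constraint\<close>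

lemma no_additive_jumps: "AE x in M. jump_times (\<lambda>t. N t x) = {} \<or> \<theta>\<^sub>1 = 0"
proof (cases "lam = 0")
  case True
  from no_jumps_if_no_intensity[OF this] show ?thesis by eventually_elim simp
qed (use lam_theta1 in simp)

text \<open>Uniqueness for the jump equation: the supremum ranges over all processes
  \<open>A\<close> compatible with \<open>c\<close>, so the product form is needed for every one of
  them. In both cases of \<open>no_additive_jumps\<close> the constant
  \<open>\<theta>\<^sub>1\<close> drops out of the jump sum.\<close>

lemma state_eq:
  assumes cA: "controlled_pair M F N \<delta> \<theta>\<^sub>1 \<theta>\<^sub>2 a c A"
  shows "AE x in M. (\<forall>T. set_integrable lborel {0..T} (\<lambda>s. c s x / D s x)) \<and>
           (\<forall>t\<ge>0. A t x = D t x * B c t x)"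
proof -
  have c: "admissible M F c" and A: "state_process M F N \<delta> \<theta>\<^sub>1 \<theta>\<^sub>2 a c A"
    using cA by (auto simp: controlled_pair_def)
  from A have "AE x in M. cadlag (\<lambda>t. A t x) \<and>
      (\<forall>t\<ge>0. A t x = a + (LINT s:{0..t}|lborel. c s x - \<delta> * A s x)
       + (\<Sum>\<tau>\<in>jump_times (\<lambda>s. N s x) \<inter> {..t}. \<theta>\<^sub>1 + \<theta>\<^sub>2 * left_lim (\<lambda>s. A s x) \<tau>))"
    unfolding state_process_def cadlag_def by (auto elim: eventually_mono)
  with control_integrable[OF c] no_additive_jumps AE_space show ?thesis
  proof eventually_elim
    case (elim x)
    interpret counting_path "\<lambda>t. N t x" by (rule counting_path[OF elim(3)])
    have th: "\<theta>\<^sub>2 \<noteq> - 1" using theta2 by simp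
    have sum: "(\<Sum>\<tau>\<in>jump_times (\<lambda>s. N s x) \<inter> {..t}. \<theta>\<^sub>1 + \<theta>\<^sub>2 * left_lim (\<lambda>s. A s x) \<tau>)
       = (\<Sum>\<tau>\<in>jump_times (\<lambda>s. N s x) \<inter> {..t}. \<theta>\<^sub>2 * left_lim (\<lambda>s. A s x) \<tau>)" for t
      using elim(2) by auto
    have eq: "A t x = a + (LINT s:{0..t}|lborel. c s x - \<delta> * A s x)
       + (\<Sum>\<tau>\<in>jump_times (\<lambda>s. N s x) \<inter> {..t}. \<theta>\<^sub>2 * left_lim (\<lambda>s. A s x) \<tau>)" if "0 \<le> t" for t
      using elim(4) that unfolding sum by blast
    note lin = linear_equation_unique[where A = "\<lambda>t. A t x" and c = "\<lambda>s. c s x",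
        OF N_start[OF elim(3)] th elim(1)[rule_format] conjunct1[OF elim(4)] eq]
    show ?case
      using lin(1)[OF _ order_refl] lin(2) by (auto simp: D_def B_def)
  qed
qed

text \<open>The chain rule for \<open>- (y powr (- q)) / q\<close> along \<open>B c\<close>, which
  starts at \<open>a > 0\<close> and increases, hence avoids the singularity at 0.\<close>

lemma H_integral:
  assumes c: "admissible M F c" and x: "x \<in> space M"
    and i: "\<And>T. set_integrable lborel {0..T} (\<lambda>s. c s x / D s x)" and t: "0 \<le> t"
  shows "set_integrable lborel {0..t} (\<lambda>s. H c s x)"
    and "(LINT s:{0..t}|lborel. H c s x) = y0 - B c t x powr (- q) / q"
proof -
  have nn: "0 \<le> c v x / D v x" if "0 \<le> v" for v
    using c_pos[OF c that x] D[of v x] by simp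
  have G: "((\<lambda>y. - (y powr (- q)) / q) has_real_derivative y powr (- (q + 1))) (at y)" if "a \<le> y" for y
  proof -
    have "((\<lambda>y. y powr (- q)) has_real_derivative - q * y powr (- q - 1)) (at y)"
      by (rule has_real_derivative_powr) (use that a_pos in simp)
    from DERIV_cdivide[OF DERIV_minus[OF this], of q] q show ?thesis
      by (simp add: minus_add_distrib)
  qed
  have g: "continuous_on {a..} (\<lambda>y. y powr (- (q + 1)))"
    using a_pos by (intro continuous_intros) auto
  note ch = chain_rule_primitive[OF i nn G g t]
  show "set_integrable lborel {0..t} (\<lambda>s. H c s x)"
    using ch(1) by (simp add: H_def B_def)
  show "(LINT s:{0..t}|lborel. H c s x) = y0 - B c t x powr (- q) / q"
    using ch(2) by (simp add: H_def B_def y0_def)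
qed

lemma horizon_integral_martingale_H_le:
  assumes cA: "controlled_pair M F N \<delta> \<theta>\<^sub>1 \<theta>\<^sub>2 a c A"
  shows "horizon_integral (\<lambda>t x. power_martingale z t x * H c t x) \<le> ennreal y0"
proof (rule horizon_integral_martingale_adapted_le)
  have c: "admissible M F c" and A: "state_process M F N \<delta> \<theta>\<^sub>1 \<theta>\<^sub>2 a c A"
    using cA by (auto simp: controlled_pair_def)
  show "jointly_measurable M (H c)" by (rule jointly_measurable_H[OF c])
  show "0 \<le> z" "0 \<le> y0" using z y0 by auto
  show "0 \<le> H c t x" if "0 \<le> t" "x \<in> space M" for t x using H_pos[OF c that] by simp
  show "\<exists>g. g \<in> borel_measurable (F t) \<and> (AE x in M. H c t x = g x)" if t: "0 \<le> t" for t
  proof (intro exI conjI)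
    have [measurable]: "c t \<in> borel_measurable (F t)"
      using c t by (intro predictable_section) (auto simp: admissible_def)
    have [measurable]: "A t \<in> borel_measurable (F t)" using A t by (simp add: state_process_def)
    note [measurable] = N_adapted[OF t]
    have [measurable]: "D t \<in> borel_measurable (F t)" unfolding D_def by measurable
    \<comment> \<open>In the adapted version \<open>A / D\<close> replaces \<open>B c\<close>:
      \<open>A\<close> is adapted by assumption, and the two agree almost surely.\<close>
    show "(\<lambda>x. c t x / D t x * (A t x / D t x) powr (- (q + 1))) \<in> borel_measurable (F t)" by measurable
    show "AE x in M. H c t x = c t x / D t x * (A t x / D t x) powr (- (q + 1))"
      using state_eq[OF cA]
    proof eventually_elim
      case (elim x)
      then have "A t x = D t x * B c t x" using t by simp
      then have "A t x / D t x = B c t x" using D[of t x] by simp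
      then show ?case by (simp add: H_def)
    qed
  qed
  show "AE x in M. (\<integral>\<^sup>+t\<in>{0..T}. ennreal (H c t x) \<partial>lborel) \<le> ennreal y0" if T: "0 \<le> T" for T
    using state_eq[OF cA] AE_space
  proof eventually_elim
    case (elim x)
    note HI = H_integral[OF c elim(2) elim(1)[THEN conjunct1, rule_format] T]
    have "(\<integral>\<^sup>+t\<in>{0..T}. ennreal (H c t x) \<partial>lborel) = (\<integral>\<^sup>+t. ennreal (indicator {0..T} t *\<^sub>R H c t x) \<partial>lborel)"
      by (rule nn_integral_cong) (simp add: indicator_def)
    also have "\<dots> = ennreal (LINT t:{0..T}|lborel. H c t x)"
      unfolding set_lebesgue_integral_def
      using HI(1) H_pos[OF c _ elim(2)]
      by (intro nn_integral_eq_integral) (auto simp: set_integrable_def indicator_def less_imp_le)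
    also have "\<dots> \<le> ennreal y0"
      unfolding HI(2) using q by (intro ennreal_leI) simp
    finally show ?case .
  qed
qed

text \<open>Because \<open>\<kappa> * q > 0\<close>, the primitive
  \<open>- (y0 * exp (- (\<kappa> * q * t)))\<close> vanishes at infinity and no budget is left
  over.\<close>

lemma H_opt_nn_integral: "(\<integral>\<^sup>+t\<in>{0..}. ennreal (H_opt t) \<partial>lborel) = ennreal y0"
proof -
  define G where "G = (\<lambda>t. - (y0 * exp (- (\<kappa> * q * t))))"
  have "(\<integral>\<^sup>+t. ennreal (H_opt t) * indicator {0..} t \<partial>lborel) = 0 - G 0"
  proof (rule nn_integral_FTC_atLeast)
    show "DERIV G t :> H_opt t" for t
      unfolding G_def H_opt_def y0_def using q by (auto intro!: derivative_eq_intros simp: field_simps)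
    have "((\<lambda>t. exp (- (\<kappa> * q * t))) \<longlongrightarrow> 0) at_top"
      using kappa q by (intro filterlim_compose[OF exp_at_bot] filterlim_uminus_at_bot[THEN iffD2])
        (auto intro!: filterlim_tendsto_pos_mult_at_top[OF tendsto_const] filterlim_ident)
    then show "(G \<longlongrightarrow> 0) at_top"
      using tendsto_minus[OF tendsto_mult_left[of "\<lambda>t. exp (- (\<kappa> * q * t))" 0 at_top y0]] by (simp add: G_def)
  qed (use H_opt in \<open>auto simp: less_imp_le\<close>, simp add: H_opt_def)
  then show ?thesis by (simp add: G_def)
qed

text \<open>The height of the convex function \<open>h powr (- \<phi>)\<close> at
  \<open>h = H c t x\<close> above its tangent at \<open>H_opt t\<close>, multiplied by
  \<open>H_opt t powr (1 + \<phi>)\<close>.\<close>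

definition gap :: "(real \<Rightarrow> 'a \<Rightarrow> real) \<Rightarrow> real \<Rightarrow> 'a \<Rightarrow> real" where
  "gap c t x = H_opt t powr (1 + \<phi>) * H c t x powr (- \<phi>) + \<phi> * H c t x - (1 + \<phi>) * H_opt t"

lemma H_opt_measurable: "H_opt \<in> borel_measurable borel"
  unfolding H_opt_def by measurable

lemma jointly_measurable_gap:
  assumes c: "admissible M F c"
  shows "jointly_measurable M (gap c)"
proof -
  note [measurable] = H_opt_measurable
  have "jointly_measurable M (\<lambda>t x. (H_opt t powr (1 + \<phi>) * H c t x powr (- \<phi>) + \<phi> * H c t x) + (- ((1 + \<phi>) * H_opt t)))"
    by (intro jointly_measurable_mult jointly_measurable_add jointly_measurable_time jointly_measurable_H c
      jointly_measurable_cmult jointly_measurable_compose[where h = "\<lambda>y. y powr (- \<phi>)"]) measurable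
  then show ?thesis by (simp add: gap_def[abs_def])
qed

lemma gap_nonneg: "admissible M F c \<Longrightarrow> 0 \<le> t \<Longrightarrow> x \<in> space M \<Longrightarrow> 0 \<le> gap c t x"
  using young_inequality(1)[OF phi H_opt H_pos] by (simp add: gap_def)

lemma cost_eq:
  assumes cA: "controlled_pair M F N \<delta> \<theta>\<^sub>1 \<theta>\<^sub>2 a c A"
  shows "cost c A = horizon_integral (\<lambda>t x. C * (power_martingale z t x * (H_opt t powr (1 + \<phi>) * H c t x powr (- \<phi>))))"
  unfolding cost_def
proof (rule horizon_integral_cong_AE)
  have c: "admissible M F c" using cA by (auto simp: controlled_pair_def)
  show "AE x in M. AE t in lborel. 0 \<le> t \<longrightarrow> A t x powr \<omega> * c t x powr (- \<phi>) * exp (- \<rho> * t)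
      = C * (power_martingale z t x * (H_opt t powr (1 + \<phi>) * H c t x powr (- \<phi>)))"
    using state_eq[OF cA] AE_space
  proof eventually_elim
    case (elim x)
    show ?case
    proof (intro AE_I2 impI)
      fix t :: real assume t: "0 \<le> t"
      show "A t x powr \<omega> * c t x powr (- \<phi>) * exp (- \<rho> * t)
        = C * (power_martingale z t x * (H_opt t powr (1 + \<phi>) * H c t x powr (- \<phi>)))"
        using cost_density[OF B_pos[OF c elim(2)] H_pos[OF c t elim(2)], of t x t]
          control_eq[OF c elim(2), of t] elim(1) t by simp
    qed
  qed
qed

text \<open>The definition of \<open>gap\<close> integrated against the weight, arranged so that
  both sides contain only nonnegative terms and the identity survives infinite cost.\<close>

lemma cost_decomposition:
  assumes cA: "controlled_pair M F N \<delta> \<theta>\<^sub>1 \<theta>\<^sub>2 a c A"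
  shows "cost c A + ennreal (\<phi> * C) * horizon_integral (\<lambda>t x. power_martingale z t x * H c t x)
    = ennreal ((1 + \<phi>) * C * y0) + horizon_integral (\<lambda>t x. C * (power_martingale z t x * gap c t x))"
proof -
  have c: "admissible M F c" using cA by (auto simp: controlled_pair_def)
  note [measurable] = H_opt_measurable
  have Zn: "0 \<le> power_martingale z t x" for t x using z by (simp add: power_martingale_nonneg)
  have jH: "jointly_measurable M (\<lambda>t x. power_martingale z t x * H c t x)"
    by (intro jointly_measurable_mult jointly_measurable_power_martingale jointly_measurable_H c)
  have jP: "jointly_measurable M (\<lambda>t x. C * (power_martingale z t x * (H_opt t powr (1 + \<phi>) * H c t x powr (- \<phi>))))"
    by (intro jointly_measurable_mult jointly_measurable_power_martingale jointly_measurable_time jointly_measurable_H c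
      jointly_measurable_cmult jointly_measurable_compose[where h = "\<lambda>y. y powr (- \<phi>)"]) measurable
  have jG: "jointly_measurable M (\<lambda>t x. C * (power_martingale z t x * gap c t x))"
    by (intro jointly_measurable_mult jointly_measurable_power_martingale jointly_measurable_gap c jointly_measurable_cmult)
  have jh: "jointly_measurable M (\<lambda>t x. power_martingale z t x * H_opt t)"
    by (intro jointly_measurable_mult jointly_measurable_power_martingale jointly_measurable_time) measurable
  have "cost c A + ennreal (\<phi> * C) * horizon_integral (\<lambda>t x. power_martingale z t x * H c t x)
      = horizon_integral (\<lambda>t x. C * (power_martingale z t x * (H_opt t powr (1 + \<phi>) * H c t x powr (- \<phi>)))) + horizon_integral (\<lambda>t x. (\<phi> * C) * (power_martingale z t x * H c t x))"
    using phi C by (simp add: cost_eq[OF cA] horizon_integral_cmult[OF jH])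
  also have "\<dots> = horizon_integral (\<lambda>t x. C * (power_martingale z t x * (H_opt t powr (1 + \<phi>) * H c t x powr (- \<phi>))) + (\<phi> * C) * (power_martingale z t x * H c t x))"
    using phi C Zn H_pos[OF c] by (intro horizon_integral_add[symmetric] jP jointly_measurable_cmult jH) (auto simp: less_imp_le)
  also have "(\<lambda>t x. C * (power_martingale z t x * (H_opt t powr (1 + \<phi>) * H c t x powr (- \<phi>))) + (\<phi> * C) * (power_martingale z t x * H c t x))
      = (\<lambda>t x. ((1 + \<phi>) * C) * (power_martingale z t x * H_opt t) + C * (power_martingale z t x * gap c t x))"
    by (intro ext) (simp add: gap_def algebra_simps)
  also have "horizon_integral \<dots> = horizon_integral (\<lambda>t x. ((1 + \<phi>) * C) * (power_martingale z t x * H_opt t)) + horizon_integral (\<lambda>t x. C * (power_martingale z t x * gap c t x))"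
    using phi C Zn H_opt gap_nonneg[OF c] by (intro horizon_integral_add jG jointly_measurable_cmult jh) (auto simp: less_imp_le)
  also have "horizon_integral (\<lambda>t x. ((1 + \<phi>) * C) * (power_martingale z t x * H_opt t)) = ennreal ((1 + \<phi>) * C * y0)"
  proof -
    have "horizon_integral (\<lambda>t x. power_martingale z t x * H_opt t) = ennreal y0"
      using H_opt z by (simp add: horizon_integral_martingale_time[OF H_opt_measurable] H_opt_nn_integral less_imp_le)
    then show ?thesis using phi C y0 by (simp add: horizon_integral_cmult[OF jh] flip: ennreal_mult)
  qed
  finally show ?thesis .
qed

text \<open>The constraint bounds the \<open>H\<close> term by \<open>\<phi> * C * y0\<close>, which
  is finite and can be cancelled. The gap term is kept because it measures the distance from
  optimality.\<close>

lemma cost_ge: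
  assumes cA: "controlled_pair M F N \<delta> \<theta>\<^sub>1 \<theta>\<^sub>2 a c A"
  shows "ennreal (C * y0) + horizon_integral (\<lambda>t x. C * (power_martingale z t x * gap c t x)) \<le> cost c A"
proof -
  have "ennreal (\<phi> * C * y0) + (ennreal (C * y0) + horizon_integral (\<lambda>t x. C * (power_martingale z t x * gap c t x)))
      = ennreal ((1 + \<phi>) * C * y0) + horizon_integral (\<lambda>t x. C * (power_martingale z t x * gap c t x))"
    using phi C y0 by (simp add: add.assoc[symmetric] algebra_simps flip: ennreal_plus)
  also have "\<dots> = cost c A + ennreal (\<phi> * C) * horizon_integral (\<lambda>t x. power_martingale z t x * H c t x)"
    by (rule cost_decomposition[OF cA, symmetric])
  also have "\<dots> \<le> cost c A + ennreal (\<phi> * C) * ennreal y0"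
    by (intro add_left_mono mult_left_mono horizon_integral_martingale_H_le[OF cA]) simp
  also have "\<dots> = ennreal (\<phi> * C * y0) + cost c A"
    using phi C y0 by (simp add: add.commute flip: ennreal_mult)
  finally show ?thesis
    by (subst (asm) ennreal_add_left_cancel_le) auto
qed

text \<open>A cost at the lower bound leaves no room for the gap, so equality holds in Young's
  inequality almost everywhere. This identifies \<open>H c\<close>, hence \<open>B c\<close> by
  integration, hence \<open>c\<close>.\<close>

lemma optimal_feedback:
  assumes cA: "controlled_pair M F N \<delta> \<theta>\<^sub>1 \<theta>\<^sub>2 a c A" and le: "cost c A \<le> ennreal (C * y0)"
  shows "AE x in M. AE t in lborel. 0 \<le> t \<longrightarrow> c t x = \<kappa> * A t x"
proof -
  have c: "admissible M F c" using cA by (auto simp: controlled_pair_def)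
  have "ennreal (C * y0) + horizon_integral (\<lambda>t x. C * (power_martingale z t x * gap c t x)) \<le> ennreal (C * y0) + 0"
    using order_trans[OF cost_ge[OF cA] le] by simp
  then have 0: "horizon_integral (\<lambda>t x. C * (power_martingale z t x * gap c t x)) = 0"
    by (subst (asm) ennreal_add_left_cancel_le) auto
  have jG: "jointly_measurable M (\<lambda>t x. C * (power_martingale z t x * gap c t x))"
    by (intro jointly_measurable_mult jointly_measurable_power_martingale jointly_measurable_gap c jointly_measurable_cmult)
  show ?thesis
    using horizon_integral_eq_0[OF jG 0] state_eq[OF cA] AE_space
  proof eventually_elim
    case (elim x)
    have Hh: "AE t in lborel. 0 \<le> t \<longrightarrow> H c t x = H_opt t"
      using elim(1)
    proof eventually_elim
      case (elim t)
      show ?case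
      proof
        assume t: "0 \<le> t"
        have "0 < C * power_martingale z t x" using C z by (simp add: power_martingale_pos)
        moreover have "(C * power_martingale z t x) * gap c t x \<le> 0" using elim t by (simp add: mult.assoc)
        ultimately have "gap c t x \<le> 0" by (meson mult_pos_pos not_le)
        then show "H c t x = H_opt t"
          using young_inequality(2)[OF phi H_opt H_pos[OF c t \<open>x \<in> space M\<close>], of t] by (simp add: gap_def)
      qed
    qed
    \<comment> \<open>Integration upgrades the almost everywhere identity for \<open>H c\<close> to
      one for \<open>B c\<close> at every time.\<close>
    have B: "B c t x = a * exp (\<kappa> * t)" if t: "0 \<le> t" for t
    proof -
      note HI = H_integral[OF c elim(3) elim(2)[THEN conjunct1, rule_format] t]
      have "(LINT s:{0..t}|lborel. H c s x) = (LINT s:{0..t}|lborel. H_opt s)"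
        unfolding set_lebesgue_integral_def
      proof (rule integral_cong_AE)
        show "(\<lambda>s. indicator {0..t} s *\<^sub>R H c s x) \<in> borel_measurable lborel"
          using HI(1) by (auto simp: set_integrable_def)
        show "(\<lambda>s. indicator {0..t} s *\<^sub>R H_opt s) \<in> borel_measurable lborel"
          using H_opt_measurable by measurable
        show "AE s in lborel. indicator {0..t} s *\<^sub>R H c s x = indicator {0..t} s *\<^sub>R H_opt s"
          using Hh by eventually_elim (auto simp: indicator_def)
      qed
      also have "\<dots> = (- (y0 * exp (- (\<kappa> * q * t)))) - (- (y0 * exp (- (\<kappa> * q * 0))))"
        unfolding set_lebesgue_integral_def
      proof (rule integral_FTC_Icc[OF t])
        show "((\<lambda>t. - (y0 * exp (- (\<kappa> * q * t)))) has_vector_derivative H_opt s) (at s within {0..t})" for s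
          unfolding has_real_derivative_iff_has_vector_derivative[symmetric] H_opt_def y0_def
          using q by (auto intro!: derivative_eq_intros simp: field_simps)
        show "continuous_on {0..t} H_opt" unfolding H_opt_def by (intro continuous_intros)
      qed
      finally have "B c t x powr (- q) = a powr (- q) * exp (- (\<kappa> * q * t))"
        unfolding HI(2) using q by (simp add: y0_def field_simps)
      also have "\<dots> = (a * exp (\<kappa> * t)) powr (- q)"
        using a_pos by (simp add: powr_mult exp_powr_real mult_ac)
      finally have "(B c t x powr (- q)) powr (- 1 / q) = ((a * exp (\<kappa> * t)) powr (- q)) powr (- 1 / q)"
        by simp
      then show ?thesis using q a_pos B_pos[OF c elim(3), of t] by (simp add: powr_powr)
    qed
    show ?case
      using Hh
    proof eventually_elim
      case (elim t)
      show ?case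
      proof
        assume t: "0 \<le> t"
        have "H_opt t * B c t x powr q = \<kappa>"
          unfolding B[OF t] H_opt_def using a_pos
          by (simp add: powr_mult exp_powr_real powr_minus field_simps exp_minus)
        then have "H c t x * D t x * B c t x powr (q + 1) = \<kappa> * (D t x * B c t x)"
          using elim t B_pos[OF c \<open>x \<in> space M\<close>, of t] by (simp add: powr_add)
        then show "c t x = \<kappa> * A t x"
          using control_eq[OF c \<open>x \<in> space M\<close>, of t] t
            \<open>(\<forall>T. set_integrable lborel {0..T} (\<lambda>s. c s x / D s x)) \<and> (\<forall>t\<ge>0. A t x = D t x * B c t x)\<close>
          by simp
      qed
    qed
  qed
qed

section \<open>The candidate attains the lower bound\<close>

definition A_opt :: "real \<Rightarrow> 'a \<Rightarrow> real" where
  "A_opt t x = a * exp ((\<kappa> - \<delta>) * t) * (1 + \<theta>\<^sub>2) ^ N t x"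
text \<open>The number of jumps strictly before \<open>t\<close> is used to keep the control
  predictable.\<close>

definition c_opt :: "real \<Rightarrow> 'a \<Rightarrow> real" where
  "c_opt t x = \<kappa> * (a * exp ((\<kappa> - \<delta>) * t) * (1 + \<theta>\<^sub>2) ^ counting_path.pre (\<lambda>s. N s x) t)"

lemma admissible_c_opt: "admissible M F c_opt"
  unfolding admissible_def
proof (intro conjI allI ballI impI)
  show "(\<lambda>(t, x). c_opt t x) \<in> borel_measurable (predictable_sigma M F)"
    unfolding c_opt_def case_prod_beta
    by (intro borel_measurable_times borel_measurable_const measurable_compose[OF _ borel_measurable_exp]
        predictable_fst predictable_pre[unfolded case_prod_beta])
  show "0 < c_opt t x" for t x using kappa a_pos theta2 by (simp add: c_opt_def)
  fix T :: real assume T: "0 \<le> T"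
  \<comment> \<open>This dominates \<open>1 + \<theta>\<^sub>2\<close> and is at least 1, so its
    powers grow with the exponent and \<open>pre t\<close> can be replaced by
    \<open>N T x\<close>.\<close>
  define y where "y = 1 + \<bar>\<theta>\<^sub>2\<bar>"
  define k where "k = (\<kappa> * (a * exp (\<bar>\<kappa> - \<delta>\<bar> * T)))\<^sup>2"
  \<comment> \<open>Since \<open>N 0\<close> vanishes, the dominating power is that of an increment
    from time 0, with a finite Poisson exponential moment.\<close>
  have "(\<integral>\<^sup>+x. (\<integral>\<^sup>+t\<in>{0..T}. ennreal ((c_opt t x)\<^sup>2) \<partial>lborel) \<partial>M)
      \<le> (\<integral>\<^sup>+x. ennreal (k * T) * ennreal ((y\<^sup>2) ^ (N T x - N 0 x)) \<partial>M)"
  proof (rule nn_integral_mono)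
    fix x assume x: "x \<in> space M"
    interpret counting_path "\<lambda>t. N t x" by (rule counting_path[OF x])
    have "(\<integral>\<^sup>+t\<in>{0..T}. ennreal ((c_opt t x)\<^sup>2) \<partial>lborel)
        \<le> (\<integral>\<^sup>+t\<in>{0..T}. ennreal (k * (y\<^sup>2) ^ N T x) \<partial>lborel)"
    proof (rule nn_integral_mono)
      have "ennreal ((c_opt t x)\<^sup>2) \<le> ennreal (k * (y\<^sup>2) ^ N T x)" if "t \<in> {0..T}" for t
      proof (rule ennreal_leI)
        have t: "0 \<le> t" "t \<le> T" using that by auto
        have "(\<kappa> - \<delta>) * t \<le> \<bar>\<kappa> - \<delta>\<bar> * T" using t by (intro mult_mono) auto
        moreover have "(1 + \<theta>\<^sub>2) ^ pre t \<le> y ^ N T x"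
        proof -
          have "pre t \<le> N T x" using n_eq_pre[of t] N_mono[OF x t] by simp
          then have "y ^ pre t \<le> y ^ N T x" by (intro power_increasing) (auto simp: y_def)
          moreover have "(1 + \<theta>\<^sub>2) ^ pre t \<le> y ^ pre t"
            using theta2 by (intro power_mono) (auto simp: y_def)
          ultimately show ?thesis by simp
        qed
        ultimately have "c_opt t x \<le> \<kappa> * (a * exp (\<bar>\<kappa> - \<delta>\<bar> * T) * y ^ N T x)"
          unfolding c_opt_def using kappa a_pos theta2
          by (intro mult_left_mono mult_mono) auto
        then have "(c_opt t x)\<^sup>2 \<le> (\<kappa> * (a * exp (\<bar>\<kappa> - \<delta>\<bar> * T) * y ^ N T x))\<^sup>2"
          using kappa a_pos theta2 by (intro power_mono) (auto simp: c_opt_def)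
        also have "\<dots> = k * (y\<^sup>2) ^ N T x"
          by (simp add: k_def power_mult_distrib mult_ac flip: power_mult)
        finally show "(c_opt t x)\<^sup>2 \<le> k * (y\<^sup>2) ^ N T x" .
      qed
      then show "ennreal ((c_opt t x)\<^sup>2) * indicator {0..T} t \<le> ennreal (k * (y\<^sup>2) ^ N T x) * indicator {0..T} t" for t
        by (simp split: split_indicator)
    qed
    also have "\<dots> = ennreal (k * T) * ennreal ((y\<^sup>2) ^ (N T x - N 0 x))"
    proof -
      have "0 \<le> k" by (simp add: k_def)
      then show ?thesis
        using T N_start[OF x] by (subst nn_integral_cmult_indicator) (auto simp: mult_ac simp flip: ennreal_mult)
    qed
    finally show "(\<integral>\<^sup>+t\<in>{0..T}. ennreal ((c_opt t x)\<^sup>2) \<partial>lborel)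
        \<le> ennreal (k * T) * ennreal ((y\<^sup>2) ^ (N T x - N 0 x))" .
  qed
  also have "\<dots> = (\<integral>\<^sup>+x. ennreal (k * T) \<partial>M) * ennreal (exp (lam * (T - 0) * (y\<^sup>2 - 1)))"
    using T by (intro nn_integral_increment_power) auto
  also have "\<dots> < \<infinity>" by (simp add: emeasure_space_1 ennreal_mult_less_top)
  finally show "(\<integral>\<^sup>+x. (\<integral>\<^sup>+t\<in>{0..T}. ennreal ((c_opt t x)\<^sup>2) \<partial>lborel) \<partial>M) < \<infinity>" .
qed

lemma c_opt_left_lim:
  assumes "x \<in> space M" "0 \<le> t"
  shows "c_opt t x = \<kappa> * left_lim (\<lambda>s. A_opt s x) t"
proof -
  interpret counting_path "\<lambda>t. N t x" by (rule counting_path[OF assms(1)])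
  show ?thesis
    unfolding A_opt_def c_opt_def by (subst left_lim_power) (auto intro!: continuous_intros assms)
qed

lemma state_process_A_opt: "state_process M F N \<delta> \<theta>\<^sub>1 \<theta>\<^sub>2 a c_opt A_opt"
  unfolding state_process_def
proof (intro conjI allI impI)
  fix t :: real assume "0 \<le> t"
  note [measurable] = N_adapted[OF this]
  show "A_opt t \<in> borel_measurable (F t)" unfolding A_opt_def by measurable
next
  have "AE x in M. cadlag (\<lambda>t. A_opt t x) \<and>
      (\<forall>t\<ge>0. A_opt t x = a + (LINT s:{0..t}|lborel. c_opt s x - \<delta> * A_opt s x)
       + (\<Sum>\<tau>\<in>jump_times (\<lambda>s. N s x) \<inter> {..t}. \<theta>\<^sub>1 + \<theta>\<^sub>2 * left_lim (\<lambda>s. A_opt s x) \<tau>))"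
    using no_additive_jumps AE_space
  proof eventually_elim
    case (elim x)
    interpret counting_path "\<lambda>t. N t x" by (rule counting_path[OF elim(2)])
    have sum: "(\<Sum>\<tau>\<in>jump_times (\<lambda>s. N s x) \<inter> {..t}. \<theta>\<^sub>1 + \<theta>\<^sub>2 * left_lim (\<lambda>s. A_opt s x) \<tau>)
       = (\<Sum>\<tau>\<in>jump_times (\<lambda>s. N s x) \<inter> {..t}. \<theta>\<^sub>2 * left_lim (\<lambda>s. A_opt s x) \<tau>)" for t
      using elim(1) by auto
    have "cadlag (\<lambda>t. A_opt t x)"
      unfolding A_opt_def by (intro cadlag_power continuous_intros)
    moreover have "A_opt t x = a + (LINT s:{0..t}|lborel. c_opt s x - \<delta> * A_opt s x)
       + (\<Sum>\<tau>\<in>jump_times (\<lambda>s. N s x) \<inter> {..t}. \<theta>\<^sub>2 * left_lim (\<lambda>s. A_opt s x) \<tau>)" if "0 \<le> t" for t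
      unfolding A_opt_def c_opt_def by (rule linear_feedback_solution[OF N_start[OF elim(2)] that])
    ultimately show ?case unfolding sum by blast
  qed
  then show "AE x in M. (\<forall>t\<ge>0. ((\<lambda>s. A_opt s x) \<longlongrightarrow> A_opt t x) (at_right t)) \<and>
        (\<forall>t>0. \<exists>l. ((\<lambda>s. A_opt s x) \<longlongrightarrow> l) (at_left t)) \<and>
        (\<forall>t\<ge>0. A_opt t x = a + (LINT s:{0..t}|lborel. c_opt s x - \<delta> * A_opt s x)
             + (\<Sum>\<tau>\<in>jump_times (\<lambda>s. N s x) \<inter> {..t}. \<theta>\<^sub>1 + \<theta>\<^sub>2 * left_lim (\<lambda>s. A_opt s x) \<tau>))"
    unfolding cadlag_def by eventually_elim auto
qed

lemma controlled_pair_c_opt: "controlled_pair M F N \<delta> \<theta>\<^sub>1 \<theta>\<^sub>2 a c_opt A_opt"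
  using admissible_c_opt state_process_A_opt by (simp add: controlled_pair_def)

text \<open>Off the jump times \<open>H\<close> equals \<open>H_opt\<close> along the candidate, so
  the cost density collapses to \<open>C\<close> times the martingale times \<open>H_opt\<close>,
  whose expectation and time integral are explicit.\<close>

lemma cost_c_opt: "cost c_opt A_opt = ennreal (C * y0)"
proof -
  have "cost c_opt A_opt = horizon_integral (\<lambda>t x. C * (power_martingale z t x * H_opt t))"
    unfolding cost_def
  proof (rule horizon_integral_cong_AE, use AE_space in eventually_elim)
    fix x assume x: "x \<in> space M"
    interpret counting_path "\<lambda>t. N t x" by (rule counting_path[OF x])
    \<comment> \<open>The jump times form a countable union of finite sets, hence a null
      set.\<close>
    have "AE t in lborel. \<forall>n::nat. t \<notin> jump_times (\<lambda>t. N t x) \<inter> {..real n}"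
      unfolding AE_all_countable
    proof
      fix n :: nat
      show "AE t in lborel. t \<notin> jump_times (\<lambda>t. N t x) \<inter> {..real n}"
        by (rule AE_I'[OF finite_imp_null_set_lborel[OF finite_jumps[of "real n"]]]) auto
    qed
    then show "AE t in lborel. 0 \<le> t \<longrightarrow> A_opt t x powr \<omega> * c_opt t x powr (- \<phi>) * exp (- \<rho> * t) = C * (power_martingale z t x * H_opt t)"
    proof eventually_elim
      case (elim t)
      obtain n where "t \<le> real n" using real_arch_simple by blast
      with elim have "t \<notin> jump_times (\<lambda>t. N t x)" by auto
      then have pre: "pre t = N t x" by (simp add: pre_def)
      define b where "b = a * exp (\<kappa> * t)"
      have b: "0 < b" using a_pos by (simp add: b_def)
      have A: "A_opt t x = D t x * b"
        by (simp add: A_opt_def D_def b_def algebra_simps exp_add exp_diff exp_minus field_simps)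
      have "H_opt t * b powr q = \<kappa>"
        unfolding b_def H_opt_def using a_pos
        by (simp add: powr_mult exp_powr_real powr_minus field_simps exp_minus)
      then have "H_opt t * D t x * b powr (q + 1) = \<kappa> * A_opt t x"
        using b by (simp add: powr_add A)
      also have "\<dots> = c_opt t x" by (simp add: A_opt_def c_opt_def pre)
      finally have cst: "c_opt t x = H_opt t * D t x * b powr (q + 1)" by simp
      have "H_opt t powr (1 + \<phi>) * H_opt t powr (- \<phi>) = H_opt t"
        using H_opt[of t] by (simp flip: powr_add)
      then show ?case
        unfolding A cst by (subst cost_density[OF b H_opt]) simp
    qed
  qed
  also have "\<dots> = ennreal C * horizon_integral (\<lambda>t x. power_martingale z t x * H_opt t)"
    using C by (intro horizon_integral_cmult jointly_measurable_mult jointly_measurable_power_martingale jointly_measurable_time H_opt_measurable) auto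
  also have "\<dots> = ennreal (C * y0)"
    using H_opt z C y0 by (simp add: horizon_integral_martingale_time[OF H_opt_measurable] H_opt_nn_integral less_imp_le flip: ennreal_mult)
  finally show ?thesis .
qed

lemma objective_le:
  assumes "controlled_pair M F N \<delta> \<theta>\<^sub>1 \<theta>\<^sub>2 a c A"
  shows "objective M \<rho> \<phi> \<omega> c A \<le> objective M \<rho> \<phi> \<omega> c_opt A_opt"
proof -
  have "ennreal (C * y0) \<le> ennreal (C * y0) + horizon_integral (\<lambda>t x. C * (power_martingale z t x * gap c t x))" by simp
  also have "\<dots> \<le> cost c A" by (rule cost_ge[OF assms])
  finally have "cost c_opt A_opt \<le> cost c A" by (simp add: cost_c_opt)
  then show ?thesis by (simp add: objective_eq less_eq_ennreal.rep_eq)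
qed

lemma optimal_pair_c_opt: "optimal_pair M F N \<delta> \<theta>\<^sub>1 \<theta>\<^sub>2 \<rho> \<phi> \<omega> a c_opt A_opt"
  using controlled_pair_c_opt objective_le by (simp add: optimal_pair_def)

text \<open>Comparison with \<open>c_opt\<close> bounds the cost of any optimal pair by
  \<open>C * y0\<close>, which is the equality case.\<close>

lemma optimal_pair_feedback:
  assumes "optimal_pair M F N \<delta> \<theta>\<^sub>1 \<theta>\<^sub>2 \<rho> \<phi> \<omega> a c A"
  shows "AE x in M. AE t in lborel. 0 \<le> t \<longrightarrow> c t x = \<kappa> * A t x"
proof (rule optimal_feedback)
  show "controlled_pair M F N \<delta> \<theta>\<^sub>1 \<theta>\<^sub>2 a c A" using assms by (simp add: optimal_pair_def)
  have "objective M \<rho> \<phi> \<omega> c_opt A_opt \<le> objective M \<rho> \<phi> \<omega> c A"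
    using assms controlled_pair_c_opt by (simp add: optimal_pair_def)
  then show "cost c A \<le> ennreal (C * y0)"
    by (simp add: objective_eq less_eq_ennreal.rep_eq cost_c_opt[symmetric])
qed

lemma value_function_eq:
  "value_function M F N \<delta> \<theta>\<^sub>1 \<theta>\<^sub>2 \<rho> \<phi> \<omega> a = ereal (- (C * y0))"
proof -
  have "value_function M F N \<delta> \<theta>\<^sub>1 \<theta>\<^sub>2 \<rho> \<phi> \<omega> a = objective M \<rho> \<phi> \<omega> c_opt A_opt"
    unfolding value_function_def
    by (rule antisym) (use objective_le controlled_pair_c_opt in \<open>auto intro!: Sup_least Sup_upper\<close>)
  also have "\<dots> = ereal (- (C * y0))"
    using C y0 by (simp add: objective_eq cost_c_opt enn2ereal_ennreal)
  finally show ?thesis .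
qed

end

text \<open>Optimality of the linear rule appears twice: some optimal pair follows it in predictable
  form, through left limits, and every optimal pair follows it up to null sets of times and paths,
  which the cost cannot detect. Positivity of \<open>kappa_star\<close> makes the rule a positive
  control and keeps the base of the power in \<open>K_star\<close> positive.\<close>

theorem theorem3:
  fixes M :: "'a measure" and F :: "real \<Rightarrow> 'a measure" and N :: "real \<Rightarrow> 'a \<Rightarrow> nat"
    and \<rho> \<delta> \<phi> lam\<^sub>1 \<theta>\<^sub>1 \<theta>\<^sub>2 \<omega> a :: real
  assumes "poisson_filtered_space M F N lam\<^sub>1"
    and "0 < \<rho>" and "0 < \<delta>" and "0 < \<phi>" and "0 \<le> lam\<^sub>1" and "- 1 < \<theta>\<^sub>2"
    and "lam\<^sub>1 * \<theta>\<^sub>1 = 0" and "\<phi> + 1 < \<omega>"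
    and "0 < kappa_star \<rho> \<delta> \<phi> lam\<^sub>1 \<theta>\<^sub>2 \<omega>"
    and "0 < a"
  shows "(\<exists>c A. optimal_pair M F N \<delta> \<theta>\<^sub>1 \<theta>\<^sub>2 \<rho> \<phi> \<omega> a c A \<and>
                feedback_control M (\<lambda>y. kappa_star \<rho> \<delta> \<phi> lam\<^sub>1 \<theta>\<^sub>2 \<omega> * y) c A)
       \<and> (\<forall>c A. optimal_pair M F N \<delta> \<theta>\<^sub>1 \<theta>\<^sub>2 \<rho> \<phi> \<omega> a c A \<longrightarrow>
                (AE x in M. AE t in lborel. 0 \<le> t \<longrightarrow>
                   c t x = kappa_star \<rho> \<delta> \<phi> lam\<^sub>1 \<theta>\<^sub>2 \<omega> * A t x))
       \<and> value_function M F N \<delta> \<theta>\<^sub>1 \<theta>\<^sub>2 \<rho> \<phi> \<omega> a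
           = ereal (- (K_star \<rho> \<delta> \<phi> lam\<^sub>1 \<theta>\<^sub>2 \<omega> * \<phi> / (\<omega> - \<phi>)) * a powr (\<omega> - \<phi>))"
proof -
  interpret addiction_control M F N "lam\<^sub>1" \<rho> \<delta> \<phi> \<theta>\<^sub>1 \<theta>\<^sub>2 \<omega> a
    by (rule addiction_control.intro[OF assms(1)], unfold_locales) (use assms in auto)
  have "feedback_control M (\<lambda>y. \<kappa> * y) c_opt A_opt"
    unfolding feedback_control_def by (intro AE_I2) (simp add: c_opt_left_lim)
  then show ?thesis
    using optimal_pair_c_opt optimal_pair_feedback value_function_eq C_y0
    unfolding \<kappa>_def by (intro conjI) auto
qed

end
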